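(* Let $n\in\mathbb{N}$, $0<\alpha<n$, and let $f$ be a non-negative measurable function on $\mathbb{R}^n$. Then for every $\beta\in(n-\alpha,n]$, $$I_\alpha f\in BMO(\mathbb{R}^n)\quad\text{if and only if}\quad I_\alpha f\in BMO^\beta(\mathbb{R}^n).$$ Moreover, in this case, for every $\beta\in(n-\alpha,n]$, $$\|I_\alpha f\|_{BMO(\mathbb{R}^n)}\cong\|I_\alpha f\|_{BMO^\beta(\mathbb{R}^n)},$$ i.e. there is a constant $C\ge 1$ depending only on $n,\alpha,\beta$ (not on $f$) such that $C^{-1}\|I_\alpha f\|_{BMO(\mathbb{R}^n)}\le\|I_\alpha f\|_{BMO^\beta(\mathbb{R}^n)}\le C\|I_\alpha f\|_{BMO(\mathbb{R}^n)}$.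
   Context: Riesz potential: $I_\alpha f(x)=\frac{1}{\gamma(\alpha)}\int_{\mathbb{R}^n}\frac{f(y)}{|x-y|^{n-\alpha}}\,dy$, with $\gamma(\alpha)>0$ the usual normalization constant. For $0<\beta\le n$, the Hausdorff content of $E\subseteq\mathbb{R}^n$ is $\mathcal{H}^\beta_\infty(E)=\inf\{\sum_{i}\omega_\beta r_i^\beta: E\subset\bigcup_{i=1}^\infty B(x_i,r_i)\}$, $\omega_\beta=\pi^{\beta/2}/\Gamma(\beta/2+1)$. For non-negative $g$, the Choquet integral is $\int_\Omega g\,d\mathcal{H}^\beta_\infty=\int_0^\infty\mathcal{H}^\beta_\infty(\{x\in\Omega:g(x)>t\})\,dt$. Here $\Omega$ is $\mathbb{R}^n$ or an open cube; $\ell(Q)$ is the side length of a cube $Q$. A function $g$ on $\Omega$ is $\mathcal{H}^\beta_\infty$-quasicontinuous if for every $\epsilon>0$ there is an open set $O\subseteq\Omega$ with $\mathcal{H}^\beta_\infty(O)<\epsilon$ such that $g$ restricted to $\Omega\setminus O$ is continuous; functions need only be defined and finite outside a set of zero $\mathcal{H}^\beta_\infty$ content. $L^1(\Omega;\mathcal{H}^\beta_\infty)$ is the set of $\mathcal{H}^\beta_\infty$-quasicontinuous $g$ with $\int_\Omega|g|\,d\mathcal{H}^\beta_\infty<\infty$, and $g\in L^1_{loc}(\mathbb{R}^n;\mathcal{H}^\beta_\infty)$ means $g|_Q\in L^1(Q;\mathcal{H}^\beta_\infty)$ for every (finite, open) cube $Q$. $BMO^\beta(\mathbb{R}^n)$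 is the set of $u\in L^1_{loc}(\mathbb{R}^n;\mathcal{H}^\beta_\infty)$ with $$\|u\|_{BMO^\beta(\mathbb{R}^n)}:=\sup_{Q\subseteq\mathbb{R}^n}\inf_{c\in\mathbb{R}}\frac{1}{\ell(Q)^\beta}\int_Q|u-c|\,d\mathcal{H}^\beta_\infty<\infty,$$ the supremum being over all finite cubes $Q$. $BMO(\mathbb{R}^n)$ is the usual space of $u\in L^1_{loc}(\mathbb{R}^n)$ (Lebesgue measure) with $\|u\|_{BMO(\mathbb{R}^n)}=\sup_Q\inf_{c}\frac{1}{\ell(Q)^n}\int_Q|u-c|\,dx<\infty$ (up to equivalent norm). *)

theory Defs
  imports "HOL-Analysis.Analysis"
begin

text \<open>
  Extended-real-valued functions model functions that are defined and finite only outside a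
  negligible set: the exceptional points are those where the value is infinite.
\<close>

definition riesz_const :: "nat \<Rightarrow> real \<Rightarrow> real" where
  "riesz_const n \<alpha> =
     pi powr (real n / 2) * 2 powr \<alpha> * Gamma (\<alpha> / 2) / Gamma ((real n - \<alpha>) / 2)"

definition riesz_potential :: "real \<Rightarrow> ('a::euclidean_space \<Rightarrow> ennreal) \<Rightarrow> 'a \<Rightarrow> ennreal" where
  "riesz_potential \<alpha> f x =
     (\<integral>\<^sup>+ y. f y / ennreal (dist x y powr (real DIM('a) - \<alpha>)) \<partial>lebesgue)
       / ennreal (riesz_const DIM('a) \<alpha>)"

text \<open>
  The library constant \<^const>\<open>unit_ball_vol\<close> is defined at every real \<open>\<beta> \<ge> 0\<close> by
  \<open>pi powr (\<beta> / 2) / Gamma (\<beta> / 2 + 1)\<close>. Radius 0 gives an empty ball, so finite covers are included.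
\<close>

definition hausdorff_content :: "real \<Rightarrow> 'a::euclidean_space set \<Rightarrow> ennreal" where
  "hausdorff_content \<beta> E =
     Inf {(\<Sum>i. ennreal (unit_ball_vol \<beta> * r i powr \<beta>)) | x r.
            (\<forall>i::nat. 0 \<le> r i) \<and> E \<subseteq> (\<Union>i. ball (x i) (r i))}"

definition choquet_integral ::
  "real \<Rightarrow> 'a::euclidean_space set \<Rightarrow> ('a \<Rightarrow> ennreal) \<Rightarrow> ennreal" where
  "choquet_integral \<beta> \<Omega> g =
     (\<integral>\<^sup>+ t \<in> {0<..}. hausdorff_content \<beta> {x \<in> \<Omega>. g x > ennreal t} \<partial>lborel)"

definition open_cube :: "'a::euclidean_space \<Rightarrow> real \<Rightarrow> 'a set" where
  "open_cube a l = box a (a + l *\<^sub>R One)"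

definition quasicontinuous_on ::
  "real \<Rightarrow> 'a::euclidean_space set \<Rightarrow> ('a \<Rightarrow> ereal) \<Rightarrow> bool" where
  "quasicontinuous_on \<beta> \<Omega> g \<longleftrightarrow>
     (\<forall>\<epsilon>>0. \<exists>U. open U \<and> U \<subseteq> \<Omega> \<and> hausdorff_content \<beta> U < ennreal \<epsilon> \<and>
        (\<forall>x\<in>\<Omega> - U. \<bar>g x\<bar> \<noteq> \<infinity>) \<and> continuous_on (\<Omega> - U) g)"

definition L1_content :: "real \<Rightarrow> 'a::euclidean_space set \<Rightarrow> ('a \<Rightarrow> ereal) set" where
  "L1_content \<beta> \<Omega> =
     {g. hausdorff_content \<beta> {x \<in> \<Omega>. \<bar>g x\<bar> = \<infinity>} = 0 \<and> quasicontinuous_on \<beta> \<Omega> g \<and>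
         choquet_integral \<beta> \<Omega> (\<lambda>x. e2ennreal \<bar>g x\<bar>) < \<infinity>}"

definition L1_loc_content :: "real \<Rightarrow> ('a::euclidean_space \<Rightarrow> ereal) set" where
  "L1_loc_content \<beta> = {g. \<forall>a. \<forall>l>0. g \<in> L1_content \<beta> (open_cube a l)}"

definition BMO_content_norm :: "real \<Rightarrow> ('a::euclidean_space \<Rightarrow> ereal) \<Rightarrow> ennreal" where
  "BMO_content_norm \<beta> u =
     (SUP a. SUP l\<in>{0<..}. INF c::real.
        choquet_integral \<beta> (open_cube a l) (\<lambda>x. e2ennreal \<bar>u x - ereal c\<bar>) / ennreal (l powr \<beta>))"

definition BMO_content :: "real \<Rightarrow> ('a::euclidean_space \<Rightarrow> ereal) set" where
  "BMO_content \<beta> = {u \<in> L1_loc_content \<beta>. BMO_content_norm \<beta> u < \<infinity>}"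

text \<open>Finiteness almost everywhere follows from finiteness of the local integrals.\<close>

definition L1_loc :: "('a::euclidean_space \<Rightarrow> ereal) set" where
  "L1_loc = {u \<in> borel_measurable lebesgue.
     \<forall>K. compact K \<longrightarrow> (\<integral>\<^sup>+ x \<in> K. e2ennreal \<bar>u x\<bar> \<partial>lebesgue) < \<infinity>}"

definition BMO_norm :: "('a::euclidean_space \<Rightarrow> ereal) \<Rightarrow> ennreal" where
  "BMO_norm u =
     (SUP a. SUP l\<in>{0<..}. INF c::real.
        (\<integral>\<^sup>+ x \<in> open_cube a l. e2ennreal \<bar>u x - ereal c\<bar> \<partial>lebesgue) / ennreal (l ^ DIM('a)))"

definition BMO :: "('a::euclidean_space \<Rightarrow> ereal) set" where
  "BMO = {u \<in> L1_loc. BMO_norm u < \<infinity>}"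

end

theory Submission
  imports Defs
begin

text \<open>
  Put \<open>\<theta> = n - \<alpha>\<close> and let \<open>N\<close> be the measure whose density is \<open>f\<close> divided by the normalising
  constant, so that the Riesz potential at \<open>x\<close> is the integral of \<open>dist x y powr -\<theta>\<close> against \<open>N\<close>.
  Both oscillation conditions turn out to say the same about \<open>N\<close>: it satisfies the Morrey growth
  condition \<open>N (ball x r) \<le> M * r powr \<theta>\<close> for all balls, with \<open>M\<close> comparable to the norm.

  \<^item> A subset \<open>E\<close> of a cube of side \<open>l\<close> has Lebesgue measure at most a constant times
    \<open>l powr (n - \<beta>)\<close> times its content, and a layer-cake argument turns this into domination of the
    Lebesgue norm by the content norm (\<open>BMO_norm_le_content_norm\<close>).

  \<^item> Bounded mean oscillation makes the averages of the potential over concentric cubes of sizes \<open>r\<close>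
    and \<open>2 ^ i * r\<close> differ by at most a multiple of \<open>i\<close>. Such an average is the integral against
    \<open>N\<close> of the averaged kernel. The averaged kernel need not decrease with the size of the cube
    (it does not for small \<open>\<alpha>\<close>), so one pair of sizes does not suffice. But a mixture of all the sizes
    with geometric weights \<open>(1 - q) * q ^ i\<close> and \<open>q\<close> close to \<open>1\<close> stays below the kernel averaged at
    size \<open>r\<close>, with a gap of order \<open>r powr -\<theta>\<close> on \<open>ball x r\<close> (\<open>geometric_mixture_kernel_bound\<close>).
    The gap bounds \<open>N (ball x r)\<close>, because the weights have a finite first moment
    (\<open>BMO_potential_imp_morrey\<close>).

  \<^item> Conversely, assume the growth condition and let a cube lie in a ball of radius \<open>d\<close>. The potential
    whose kernel is frozen at distances below \<open>d\<close> varies on the cube by at most a multiple of \<open>M\<close>.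
    The remainder is a potential over \<open>ball x d\<close>. Where \<open>N (ball x r) \<le> s * r powr \<beta>\<close> for all
    \<open>r \<le> d\<close>, the geometric mean of this bound and the growth condition decays faster than
    \<open>r powr \<theta>\<close>, and the remainder is at most of order \<open>sqrt (M * s)\<close>. By Vitali's covering lemma the
    exceptional points have content of order \<open>1 / s\<close>. Hence the content of the set where the
    remainder exceeds \<open>t\<close> decays like \<open>1 / t\<^sup>2\<close>, which is integrable at infinity
    (\<open>choquet_integral_local_potential_le\<close>). Freezing the kernel at ever smaller distances exhibits
    the potential, away from the open exceptional set, as a uniform limit of Lipschitz functions;
    this is quasicontinuity (\<open>potential_quasicontinuous\<close>).
\<close>

section \<open>Extended non-negative reals, balls and cubes\<close>

lemma ennreal_le_of_inverse_mult_le: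
  assumes "0 < c" "ennreal (1 / c) * X \<le> Y"
  shows "X \<le> ennreal c * Y"
proof -
  have "X = ennreal c * (ennreal (1 / c) * X)"
    using assms(1) by (simp add: mult.assoc[symmetric] ennreal_mult[symmetric])
  also have "\<dots> \<le> ennreal c * Y" using assms(2) by (intro mult_left_mono) auto
  finally show ?thesis .
qed

lemma ennreal_le_suminf:
  fixes f :: "nat \<Rightarrow> ennreal"
  shows "f j \<le> (\<Sum>k. f k)"
  using sum_le_suminf[of f "{j}"] by simp

lemma ball_measurable [measurable]: "ball x r \<in> sets borel"
  by simp

lemma extended_abs_diff_top [simp]: "e2ennreal \<bar>enn2ereal top - ereal c\<bar> = top"
  by (simp add: top_ereal_def)

lemma extended_abs_diff_ennreal:
  assumes "0 \<le> r"
  shows "e2ennreal \<bar>enn2ereal (ennreal r) - ereal c\<bar> = ennreal \<bar>r - c\<bar>"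
  using assms by (simp add: enn2ereal_ennreal)

text \<open>
  The form in which oscillation is estimated: \<open>v\<close> is a smooth part \<open>T\<close>, which stays within \<open>K\<close> of
  the constant \<open>c\<close>, plus a non-negative remainder bounded by \<open>w\<close>.
\<close>

lemma extended_abs_diff_le:
  assumes "0 \<le> c" "0 \<le> K" "v \<le> T + w" "T \<le> v" "T \<le> ennreal c + ennreal K" "ennreal c \<le> T + ennreal K"
  shows "e2ennreal \<bar>enn2ereal v - ereal c\<bar> \<le> w + ennreal K"
proof (cases v)
  case (real r)
  have "T \<noteq> top" using assms(4) real by (auto simp: top_unique)
  then obtain t where t: "T = ennreal t" "0 \<le> t" by (cases T) auto
  show ?thesis
  proof (cases w)
    case (real w')
    with t \<open>v = ennreal r\<close> \<open>0 \<le> r\<close> assms have "r \<le> t + w'" "t \<le> r" "t \<le> c + K" "c \<le> t + K"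
      by (simp_all add: ennreal_plus[symmetric] del: ennreal_plus)
    then have "\<bar>r - c\<bar> \<le> w' + K" using real by linarith
    then show ?thesis using \<open>v = ennreal r\<close> \<open>0 \<le> r\<close> real assms
      by (simp add: extended_abs_diff_ennreal ennreal_plus[symmetric] del: ennreal_plus)
  qed simp
next
  case top
  have "T \<le> ennreal (c + K)" using assms(1,2,5) by (simp add: ennreal_plus)
  then have "T \<noteq> top" by (auto simp: top_unique)
  with top assms(3) have "w = top" by (simp add: top_unique ennreal_add_eq_top)
  then show ?thesis by simp
qed

lemma le_add_extended_abs_diff: "v \<le> ennreal c + e2ennreal \<bar>enn2ereal v - ereal c\<bar>"
proof (cases v)
  case (real r)
  then show ?thesis
    by (cases "0 \<le> c") (auto simp: extended_abs_diff_ennreal ennreal_neg ennreal_plus[symmetric] simp del: ennreal_plus)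
qed simp

lemma ennreal_le_add_extended_abs_diff: "ennreal c \<le> v + e2ennreal \<bar>enn2ereal v - ereal c\<bar>"
proof (cases v)
  case (real r)
  then show ?thesis
    by (auto simp: extended_abs_diff_ennreal ennreal_plus[symmetric] simp del: ennreal_plus)
qed simp

lemma emeasure_open_cube:
  fixes a :: "'a::euclidean_space"
  assumes "0 \<le> l"
  shows "emeasure lborel (open_cube a l) = ennreal (l ^ DIM('a))"
  unfolding open_cube_def using assms
  by (subst emeasure_lborel_box) (auto simp: inner_add_left)

lemma open_cube_measurable [measurable]: "open_cube a l \<in> sets borel"
  by (simp add: open_cube_def)

lemma open_cube_subset_ball:
  fixes a :: "'a::euclidean_space"
  assumes "0 < l"
  shows "open_cube a l \<subseteq> ball a (real DIM('a) * l)"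
proof
  fix x assume "x \<in> open_cube a l"
  then have x: "a \<bullet> b < x \<bullet> b \<and> x \<bullet> b < a \<bullet> b + l" if "b \<in> Basis" for b
    using that by (auto simp: open_cube_def mem_box inner_add_left)
  have "dist a x = norm (x - a)" by (simp add: dist_norm norm_minus_commute)
  also have "\<dots> \<le> (\<Sum>b\<in>Basis. \<bar>(x - a) \<bullet> b\<bar>)" by (rule norm_le_l1)
  also have "\<dots> < (\<Sum>b\<in>(Basis::'a set). l)"
  proof (rule sum_strict_mono)
    fix b :: 'a assume "b \<in> Basis"
    from x[OF this] show "\<bar>(x - a) \<bullet> b\<bar> < l" by (simp add: inner_diff_left)
  qed auto
  finally show "x \<in> ball a (real DIM('a) * l)" by simp
qed

lemma bounded_subset_open_cube:
  fixes K :: "'a::euclidean_space set"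
  assumes "bounded K"
  obtains a l where "0 < l" "K \<subseteq> open_cube a l"
proof -
  obtain r where r: "0 < r" "\<And>x. x \<in> K \<Longrightarrow> norm x < r"
    using assms by (metis bounded_pos_less)
  have "K \<subseteq> open_cube ((-r) *\<^sub>R One) (2 * r)"
  proof
    fix x assume "x \<in> K"
    then have "norm x < r" by (rule r(2))
    then have "\<bar>x \<bullet> b\<bar> < r" if "b \<in> Basis" for b using Basis_le_norm[OF that, of x] by simp
    then have "- r < x \<bullet> b \<and> x \<bullet> b < r" if "b \<in> Basis" for b
      using that by (fastforce simp: abs_less_iff)
    then show "x \<in> open_cube ((-r) *\<^sub>R One) (2 * r)"
      by (simp add: open_cube_def mem_box inner_add_left inner_diff_left)
  qed
  with r that[of "2 * r"] show ?thesis by auto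
qed

section \<open>Hausdorff content\<close>

lemma hausdorff_content_le:
  assumes "\<And>i::nat. 0 \<le> r i" "E \<subseteq> (\<Union>i. ball (x i) (r i))"
  shows "hausdorff_content \<beta> E \<le> (\<Sum>i. ennreal (unit_ball_vol \<beta> * r i powr \<beta>))"
  unfolding hausdorff_content_def using assms by (intro Inf_lower) blast

lemma hausdorff_content_mono:
  assumes "E \<subseteq> F"
  shows "hausdorff_content \<beta> E \<le> hausdorff_content \<beta> F"
  unfolding hausdorff_content_def using assms by (intro Inf_superset_mono) blast

lemma hausdorff_content_subset_ball:
  assumes "E \<subseteq> ball x r" "0 \<le> r"
  shows "hausdorff_content \<beta> E \<le> ennreal (unit_ball_vol \<beta> * r powr \<beta>)"
proof -
  have "hausdorff_content \<beta> E
      \<le> (\<Sum>i. ennreal (unit_ball_vol \<beta> * (if i = (0::nat) then r else 0) powr \<beta>))"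
    using assms by (intro hausdorff_content_le[where x = "\<lambda>_. x"]) auto
  also have "\<dots> = (\<Sum>i\<in>{0::nat}. ennreal (unit_ball_vol \<beta> * (if i = (0::nat) then r else 0) powr \<beta>))"
    by (rule suminf_finite) auto
  finally show ?thesis by simp
qed

text \<open>
  The weak-type estimate for the fractional maximal function of order \<open>\<beta>\<close>. Each point of the set is
  the centre of a ball whose \<open>N\<close>-measure controls the \<open>\<beta>\<close>-th power of its radius. By Vitali's covering
  lemma the five-fold enlargements of a disjoint subfamily still cover, and the \<open>N\<close>-measures of
  disjoint balls add up.
\<close>

lemma hausdorff_content_large_density:
  fixes N :: "'a::euclidean_space measure"
  assumes N: "sets N = sets borel" and \<beta>: "0 \<le> \<beta>" and s: "0 < s"
    and T: "T \<in> sets borel" "\<And>x. x \<in> S \<Longrightarrow> ball x L \<subseteq> T"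
  shows "hausdorff_content \<beta>
           {x\<in>S. \<exists>r. 0 < r \<and> r \<le> L \<and> ennreal (s * r powr \<beta>) < emeasure N (ball x r)}
         \<le> ennreal (unit_ball_vol \<beta> * 5 powr \<beta> / s) * emeasure N T"
proof -
  define P where "P x r \<longleftrightarrow> 0 < r \<and> r \<le> L \<and> ennreal (s * r powr \<beta>) < emeasure N (ball x r)" for x r
  define K where "K = {x\<in>S. \<exists>r. P x r}"
  define R where "R x = (SOME r. P x r)" for x
  have R: "P x (R x)" if "x \<in> K" for x
    using that unfolding K_def R_def by (auto intro: someI_ex)
  have R': "0 < R x \<and> R x \<le> L" if "x \<in> K" for x
    using R[OF that] by (auto simp: P_def)
  obtain C where C: "countable C" "C \<subseteq> K"
     "pairwise (\<lambda>i j. disjnt (ball i (R i)) (ball j (R j))) C"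
     "K \<subseteq> (\<Union>i\<in>C. ball i (5 * R i))"
    by (rule Vitali_covering_lemma_balls[where S=K and K=K and a="\<lambda>x. x" and r=R and B=L]) (use R' in auto)
  \<comment> \<open>Unused indices get radius \<open>0\<close>, hence an empty ball.\<close>
  define J where "J = to_nat_on C ` C"
  define z where "z i = inv_into C (to_nat_on C) i" for i
  define \<rho> where "\<rho> i = (if i \<in> J then R (z i) else 0)" for i
  have inj: "inj_on (to_nat_on C) C" using C(1) by (rule inj_on_to_nat_on)
  have zC: "z i \<in> C" if "i \<in> J" for i
    using that unfolding J_def z_def by (simp add: inv_into_into)
  have zi: "z (to_nat_on C x) = x" if "x \<in> C" for x
    using that inj unfolding z_def by simp
  have z_inj: "i = j" if "i \<in> J" "j \<in> J" "z i = z j" for i j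
    using that unfolding J_def z_def by (metis f_inv_into_f)
  have \<rho>0: "0 \<le> \<rho> i" for i using R' zC C(2) unfolding \<rho>_def by (auto intro: less_imp_le)
  have cov: "K \<subseteq> (\<Union>i. ball (z i) (5 * \<rho> i))"
  proof
    fix x assume "x \<in> K"
    then obtain y where y: "y \<in> C" "x \<in> ball y (5 * R y)" using C(4) by blast
    then have "x \<in> ball (z (to_nat_on C y)) (5 * \<rho> (to_nat_on C y))"
      using zi by (simp add: \<rho>_def J_def)
    then show "x \<in> (\<Union>i. ball (z i) (5 * \<rho> i))" by blast
  qed
  have disj: "disjoint_family (\<lambda>i. ball (z i) (\<rho> i))"
    unfolding disjoint_family_on_def
  proof (intro ballI impI)
    fix i j :: nat assume "i \<noteq> j"
    show "ball (z i) (\<rho> i) \<inter> ball (z j) (\<rho> j) = {}"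
    proof (cases "i \<in> J \<and> j \<in> J")
      case True
      with \<open>i \<noteq> j\<close> have "z i \<noteq> z j" using z_inj by blast
      then show ?thesis using C(3) zC True unfolding pairwise_def disjnt_def \<rho>_def by auto
    qed (auto simp: \<rho>_def)
  qed
  have "hausdorff_content \<beta> K \<le> (\<Sum>i. ennreal (unit_ball_vol \<beta> * (5 * \<rho> i) powr \<beta>))"
    using cov \<rho>0 by (intro hausdorff_content_le) auto
  also have "\<dots> \<le> (\<Sum>i. ennreal (unit_ball_vol \<beta> * 5 powr \<beta> / s) * emeasure N (ball (z i) (\<rho> i)))"
  proof (intro suminf_le)
    fix i
    show "ennreal (unit_ball_vol \<beta> * (5 * \<rho> i) powr \<beta>)
       \<le> ennreal (unit_ball_vol \<beta> * 5 powr \<beta> / s) * emeasure N (ball (z i) (\<rho> i))"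
    proof (cases "i \<in> J")
      case True
      have p: "P (z i) (\<rho> i)" using R zC[OF True] C(2) True by (auto simp: \<rho>_def)
      have "ennreal (unit_ball_vol \<beta> * (5 * \<rho> i) powr \<beta>)
        = ennreal (unit_ball_vol \<beta> * 5 powr \<beta> / s) * ennreal (s * \<rho> i powr \<beta>)"
        using s \<rho>0 unit_ball_vol_pos[OF \<beta>]
        by (subst ennreal_mult[symmetric]) (auto simp: powr_mult)
      also have "\<dots> \<le> ennreal (unit_ball_vol \<beta> * 5 powr \<beta> / s) * emeasure N (ball (z i) (\<rho> i))"
        using p unfolding P_def by (intro mult_left_mono) auto
      finally show ?thesis .
    qed (simp add: \<rho>_def)
  qed auto
  also have "\<dots> = ennreal (unit_ball_vol \<beta> * 5 powr \<beta> / s) * (\<Sum>i. emeasure N (ball (z i) (\<rho> i)))"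
    by (rule ennreal_suminf_cmult)
  also have "(\<Sum>i. emeasure N (ball (z i) (\<rho> i))) = emeasure N (\<Union>i. ball (z i) (\<rho> i))"
    using disj by (intro suminf_emeasure) (auto simp: N)
  also have "\<dots> \<le> emeasure N T"
  proof (intro emeasure_mono)
    have "ball (z i) (\<rho> i) \<subseteq> T" for i
    proof (cases "i \<in> J")
      case True
      have k: "z i \<in> K" using zC[OF True] C(2) by auto
      then have "ball (z i) (\<rho> i) \<subseteq> ball (z i) L"
        using R'[OF k] True by (intro subset_ball) (simp add: \<rho>_def)
      also have "\<dots> \<subseteq> T" using k T(2) by (auto simp: K_def)
      finally show ?thesis .
    qed (simp add: \<rho>_def)
    then show "(\<Union>i. ball (z i) (\<rho> i)) \<subseteq> T" by blast
  qed (use T N in auto)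
  finally show ?thesis unfolding K_def P_def by (simp add: mult_left_mono)
qed

text \<open>
  The measure of an open ball is the limit of those of smaller concentric balls, so the strict
  inequality survives a small shrinking of the radius, hence also a small shift of the centre.
\<close>

lemma open_large_density:
  fixes N :: "'a::euclidean_space measure"
  assumes N: "sets N = sets borel"
  shows "open {x. \<exists>r. 0 < r \<and> r \<le> L \<and> ennreal (g r) < emeasure N (ball x r)}"
  unfolding open_contains_ball
proof
  fix x assume "x \<in> {x. \<exists>r. 0 < r \<and> r \<le> L \<and> ennreal (g r) < emeasure N (ball x r)}"
  then obtain r where r: "0 < r" "r \<le> L" "ennreal (g r) < emeasure N (ball x r)" by blast
  have "ball x r = (\<Union>n. ball x (r - 1 / real (Suc n)))"
  proof (intro equalityI subsetI)
    fix y assume "y \<in> ball x r"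
    then obtain n where "inverse (real (Suc n)) < r - dist x y"
      using reals_Archimedean[of "r - dist x y"] by auto
    then have "y \<in> ball x (r - 1 / real (Suc n))" by (simp add: inverse_eq_divide)
    then show "y \<in> (\<Union>n. ball x (r - 1 / real (Suc n)))" by blast
  next
    fix y assume "y \<in> (\<Union>n. ball x (r - 1 / real (Suc n)))"
    then obtain n where "dist x y < r - 1 / real (Suc n)" by auto
    also have "\<dots> < r" by simp
    finally show "y \<in> ball x r" by simp
  qed
  moreover have "incseq (\<lambda>n. ball x (r - 1 / real (Suc n)))"
    by (intro incseq_SucI subset_ball) (simp add: frac_le)
  ultimately have "emeasure N (ball x r) = (SUP n. emeasure N (ball x (r - 1 / real (Suc n))))"
    by (subst SUP_emeasure_incseq) (auto simp: N)
  then obtain n where n: "ennreal (g r) < emeasure N (ball x (r - 1 / real (Suc n)))"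
    using r(3) by (auto simp: less_SUP_iff)
  show "\<exists>e>0. ball x e \<subseteq> {x. \<exists>r. 0 < r \<and> r \<le> L \<and> ennreal (g r) < emeasure N (ball x r)}"
  proof (intro exI conjI subsetI)
    show "0 < 1 / real (Suc n)" by simp
    fix x' assume x': "x' \<in> ball x (1 / real (Suc n))"
    have "ball x (r - 1 / real (Suc n)) \<subseteq> ball x' r"
    proof
      fix y assume "y \<in> ball x (r - 1 / real (Suc n))"
      then show "y \<in> ball x' r" using x' dist_triangle2[of x' y x] dist_triangle[of x' y x]
        by (simp add: dist_commute)
    qed
    then have "emeasure N (ball x (r - 1 / real (Suc n))) \<le> emeasure N (ball x' r)"
      by (intro emeasure_mono) (auto simp: N)
    with n r show "x' \<in> {x. \<exists>r. 0 < r \<and> r \<le> L \<and> ennreal (g r) < emeasure N (ball x r)}"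
      by (auto intro: less_le_trans)
  qed
qed

lemma quasicontinuous_infinite_null:
  assumes "quasicontinuous_on \<beta> \<Omega> g"
  shows "hausdorff_content \<beta> {x\<in>\<Omega>. \<bar>g x\<bar> = \<infinity>} = 0"
proof -
  have "hausdorff_content \<beta> {x\<in>\<Omega>. \<bar>g x\<bar> = \<infinity>} \<le> 0 + ennreal \<epsilon>" if \<epsilon>: "0 < \<epsilon>" for \<epsilon>
  proof -
    obtain U where U: "hausdorff_content \<beta> U < ennreal \<epsilon>" "\<forall>x\<in>\<Omega> - U. \<bar>g x\<bar> \<noteq> \<infinity>"
      using assms \<epsilon> unfolding quasicontinuous_on_def by blast
    have "hausdorff_content \<beta> {x\<in>\<Omega>. \<bar>g x\<bar> = \<infinity>} \<le> hausdorff_content \<beta> U"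
    proof (intro hausdorff_content_mono subsetI)
      fix x assume "x \<in> {x\<in>\<Omega>. \<bar>g x\<bar> = \<infinity>}"
      then have "x \<in> \<Omega>" "\<bar>g x\<bar> = \<infinity>" by (simp_all only: mem_Collect_eq)
      then show "x \<in> U" using U(2)[rule_format, of x] by (cases "x \<in> U") simp_all
    qed
    with U(1) show ?thesis by simp
  qed
  then have "hausdorff_content \<beta> {x\<in>\<Omega>. \<bar>g x\<bar> = \<infinity>} \<le> 0" by (rule ennreal_le_epsilon)
  then show ?thesis by simp
qed

section \<open>Choquet integrals and Lebesgue integrals\<close>

text \<open>
  Levels up to \<open>K + \<tau>\<close> are estimated trivially by the content of \<open>Q\<close>; above that the quadratic decay is
  integrated. The free parameter \<open>\<tau>\<close> lets the two contributions be balanced.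
\<close>

lemma choquet_integral_le:
  assumes KT: "0 \<le> K" "0 < \<tau>" and AB: "0 \<le> A" "0 \<le> B"
    and A: "hausdorff_content \<beta> Q \<le> ennreal A"
    and B: "\<And>t. K < t \<Longrightarrow> hausdorff_content \<beta> {x\<in>Q. ennreal t < g x} \<le> ennreal (B / (t - K)\<^sup>2)"
  shows "choquet_integral \<beta> Q g \<le> ennreal (A * (K + \<tau>) + B / \<tau>)"
proof -
  have "choquet_integral \<beta> Q g \<le> (\<integral>\<^sup>+ t. ennreal A * indicator {0..K+\<tau>} t
      + ennreal (B / (t - K)\<^sup>2) * indicator {K+\<tau>..} t \<partial>lborel)"
    unfolding choquet_integral_def
  proof (rule nn_integral_mono)
    fix t :: real
    have "hausdorff_content \<beta> {x\<in>Q. ennreal t < g x} \<le> hausdorff_content \<beta> Q"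
      by (rule hausdorff_content_mono) auto
    then have "hausdorff_content \<beta> {x\<in>Q. ennreal t < g x} \<le> ennreal A" using A by (rule order_trans)
    then show "hausdorff_content \<beta> {x\<in>Q. ennreal t < g x} * indicator {0<..} t
      \<le> ennreal A * indicator {0..K+\<tau>} t + ennreal (B / (t - K)\<^sup>2) * indicator {K+\<tau>..} t"
      using B[of t] KT by (auto simp: indicator_def add_increasing add_increasing2)
  qed
  also have "\<dots> = ennreal A * ennreal (K + \<tau>) + (\<integral>\<^sup>+ t. ennreal (B / (t - K)\<^sup>2) * indicator {K+\<tau>..} t \<partial>lborel)"
    using KT by (subst nn_integral_add) (auto simp: nn_integral_cmult_indicator)
  also have "(\<integral>\<^sup>+ t. ennreal (B / (t - K)\<^sup>2) * indicator {K+\<tau>..} t \<partial>lborel) = ennreal (0 - (- B / (K + \<tau> - K)))"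
  proof (rule nn_integral_FTC_atLeast)
    fix t assume "K + \<tau> \<le> t"
    then have "t - K \<noteq> 0" using KT by simp
    then show "((\<lambda>t. - B / (t - K)) has_real_derivative B / (t - K)\<^sup>2) (at t)"
      by (auto intro!: derivative_eq_intros simp: power2_eq_square)
  next
    have "filterlim (\<lambda>t::real. t - K) at_top at_top"
      using filterlim_tendsto_add_at_top[OF tendsto_const[of "-K"] filterlim_ident] by simp
    then show "((\<lambda>t. - B / (t - K)) \<longlongrightarrow> 0) at_top"
      by (intro real_tendsto_divide_at_top[OF tendsto_const])
  qed (use AB in auto)
  also have "ennreal A * ennreal (K + \<tau>) + ennreal (0 - (- B / (K + \<tau> - K))) = ennreal (A * (K + \<tau>) + B / \<tau>)"
    using AB KT by (simp add: ennreal_mult ennreal_plus)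
  finally show ?thesis .
qed

text \<open>
  Lebesgue integrals written in the shape of the Choquet integral, so that an inequality between the
  Lebesgue measure and the content of superlevel sets transfers to the integrals.
\<close>

lemma nn_integral_layer_cake:
  fixes g :: "'a::euclidean_space \<Rightarrow> ennreal"
  assumes [measurable]: "g \<in> borel_measurable borel" and [measurable]: "Q \<in> sets borel"
  shows "(\<integral>\<^sup>+ x \<in> Q. g x \<partial>lborel)
       = (\<integral>\<^sup>+ t \<in> {0<..}. emeasure lborel {x\<in>Q. ennreal t < g x} \<partial>lborel)"
proof -
  have height: "g x = emeasure lborel {t. 0 < t \<and> ennreal t < g x}" for x
  proof (cases "g x")
    case (real r)
    then have "{t. 0 < t \<and> ennreal t < g x} = {0<..<r}" by (auto simp: ennreal_less_iff)
    then show ?thesis using real by simp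
  next
    case top
    then have "{t. 0 < t \<and> ennreal t < g x} = {0<..}" by auto
    moreover have "emeasure lborel {0::real<..} = \<infinity>"
    proof (rule ccontr)
      assume n: "\<not> ?thesis"
      have "ennreal r \<le> emeasure lborel {0::real<..}" if "0 \<le> r" for r
       
      proof -
        have "emeasure lborel {0<..<r} \<le> emeasure lborel {0::real<..}"
          by (intro emeasure_mono) auto
        with that show ?thesis by simp
      qed
      moreover obtain r where "0 \<le> r" "emeasure lborel {0::real<..} = ennreal r"
        using n by (cases "emeasure lborel {0::real<..}") auto
      moreover have "0 \<le> r + 1" using \<open>0 \<le> r\<close> by simp
      ultimately have "ennreal (r + 1) \<le> ennreal r" by fastforce
      with \<open>0 \<le> r\<close> show False by simp
    qed
    ultimately show ?thesis using top by simp
  qed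
  have "(\<integral>\<^sup>+ x \<in> Q. g x \<partial>lborel)
      = (\<integral>\<^sup>+ x. (\<integral>\<^sup>+ t. indicator {p. fst p \<in> Q \<and> 0 < snd p \<and> ennreal (snd p) < g (fst p)} (x, t) \<partial>lborel) \<partial>lborel)"
  proof (rule nn_integral_cong)
    fix x
    have "(\<integral>\<^sup>+ t. indicator {p. fst p \<in> Q \<and> 0 < snd p \<and> ennreal (snd p) < g (fst p)} (x, t) \<partial>lborel)
       = (\<integral>\<^sup>+ t. indicator Q x * indicator {t. 0 < t \<and> ennreal t < g x} t \<partial>lborel)"
      by (intro nn_integral_cong) (auto simp: indicator_def)
    also have "\<dots> = indicator Q x * g x"
      by (subst nn_integral_cmult_indicator) (auto simp flip: height)
    finally show "g x * indicator Q x = (\<integral>\<^sup>+ t. indicator {p. fst p \<in> Q \<and> 0 < snd p \<and> ennreal (snd p) < g (fst p)} (x, t) \<partial>lborel)"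
      by (simp add: mult.commute)
  qed
  also have "\<dots> = (\<integral>\<^sup>+ t. (\<integral>\<^sup>+ x. indicator {p. fst p \<in> Q \<and> 0 < snd p \<and> ennreal (snd p) < g (fst p)} (x, t) \<partial>lborel) \<partial>lborel)"
    by (rule lborel_pair.Fubini'[symmetric]) measurable
  also have "\<dots> = (\<integral>\<^sup>+ t \<in> {0<..}. emeasure lborel {x\<in>Q. ennreal t < g x} \<partial>lborel)"
  proof (rule nn_integral_cong)
    fix t :: real
    have "(\<integral>\<^sup>+ x. indicator {p. fst p \<in> Q \<and> 0 < snd p \<and> ennreal (snd p) < g (fst p)} (x, t) \<partial>lborel)
       = (\<integral>\<^sup>+ x. indicator {0<..} t * indicator {x\<in>Q. ennreal t < g x} x \<partial>lborel)"
      by (intro nn_integral_cong) (auto simp: indicator_def)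
    also have "\<dots> = indicator {0<..} t * emeasure lborel {x\<in>Q. ennreal t < g x}"
      by (rule nn_integral_cmult_indicator) measurable
    finally show "(\<integral>\<^sup>+ x. indicator {p. fst p \<in> Q \<and> 0 < snd p \<and> ennreal (snd p) < g (fst p)} (x, t) \<partial>lborel)
      = emeasure lborel {x\<in>Q. ennreal t < g x} * indicator {0<..} t" by (simp add: mult.commute)
  qed
  finally show ?thesis .
qed

text \<open>
  In a cover of \<open>E\<close> a ball of radius \<open>r \<le> l\<close> has volume of order
  \<open>r powr n \<le> l powr (n - \<beta>) * r powr \<beta>\<close>, and a larger ball may be replaced by the cube itself.
\<close>

lemma emeasure_le_content:
  fixes a :: "'a::euclidean_space"
  assumes \<beta>: "0 < \<beta>" "\<beta> \<le> real DIM('a)" and l: "0 < l" and E: "E \<subseteq> open_cube a l"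
  shows "ennreal (1 / ((1 + unit_ball_vol (real DIM('a))) / unit_ball_vol \<beta> * l powr (real DIM('a) - \<beta>)))
         * emeasure lborel E \<le> hausdorff_content \<beta> E"
proof -
  let ?n = "real DIM('a)"
  define w where "w = unit_ball_vol \<beta>"
  define V where "V = 1 + unit_ball_vol ?n"
  have w: "0 < w" using unit_ball_vol_pos[of \<beta>] \<beta> by (simp add: w_def)
  have V: "1 \<le> V" "unit_ball_vol ?n \<le> V" using unit_ball_vol_pos[of ?n] by (auto simp: V_def)
  define c where "c = V / w * l powr (?n - \<beta>)"
  have c: "0 < c" using w V l by (simp add: c_def)
  have main: "ennreal (1 / c) * emeasure lborel E \<le> (\<Sum>i. ennreal (w * r i powr \<beta>))"
    if r: "\<forall>i::nat. 0 \<le> r i" and cov: "E \<subseteq> (\<Union>i. ball (x i) (r i))" for x :: "nat \<Rightarrow> 'a" and r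
  proof -
    have piece: "emeasure lborel (ball (x i) (r i) \<inter> open_cube a l) \<le> ennreal c * ennreal (w * r i powr \<beta>)" for i
    proof -
      have eq: "ennreal c * ennreal (w * r i powr \<beta>) = ennreal (V * l powr (?n - \<beta>) * r i powr \<beta>)"
        using c w by (subst ennreal_mult[symmetric]) (auto simp: c_def mult.assoc)
      consider "r i = 0" | "0 < r i" "r i \<le> l" | "l < r i" using r[rule_format, of i] by linarith
      then show ?thesis
      proof cases
        case 2
        have "emeasure lborel (ball (x i) (r i) \<inter> open_cube a l) \<le> emeasure lborel (ball (x i) (r i))"
          by (intro emeasure_mono) auto
        also have "\<dots> = ennreal (unit_ball_vol ?n * r i ^ DIM('a))" using 2 by (intro emeasure_ball) auto
        also have "\<dots> \<le> ennreal (V * l powr (?n - \<beta>) * r i powr \<beta>)"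
        proof (rule ennreal_leI)
          have "r i ^ DIM('a) = r i powr (?n - \<beta>) * r i powr \<beta>"
            using 2 by (simp add: powr_add[symmetric] powr_realpow)
          also have "\<dots> \<le> l powr (?n - \<beta>) * r i powr \<beta>"
            using 2 \<beta> by (intro mult_right_mono powr_mono2) auto
          finally show "unit_ball_vol ?n * r i ^ DIM('a) \<le> V * l powr (?n - \<beta>) * r i powr \<beta>"
            using V unit_ball_vol_pos[of ?n] 2 by (subst mult.assoc, intro mult_mono) auto
        qed
        finally show ?thesis unfolding eq .
      next
        case 3
        have "emeasure lborel (ball (x i) (r i) \<inter> open_cube a l) \<le> emeasure lborel (open_cube a l)"
          by (intro emeasure_mono) auto
        also have "\<dots> = ennreal (l ^ DIM('a))" using l by (intro emeasure_open_cube) auto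
        also have "\<dots> \<le> ennreal (V * l powr (?n - \<beta>) * r i powr \<beta>)"
        proof (rule ennreal_leI)
          have "l ^ DIM('a) = 1 * (l powr (?n - \<beta>) * l powr \<beta>)"
            using l by (simp add: powr_add[symmetric] powr_realpow)
          also have "\<dots> \<le> V * (l powr (?n - \<beta>) * r i powr \<beta>)"
            using 3 l \<beta> V by (intro mult_mono powr_mono2) auto
          finally show "l ^ DIM('a) \<le> V * l powr (?n - \<beta>) * r i powr \<beta>" by simp
        qed
        finally show ?thesis unfolding eq .
      qed simp
    qed
    have "emeasure lborel E \<le> emeasure lborel (\<Union>i. ball (x i) (r i) \<inter> open_cube a l)"
      using cov E by (intro emeasure_mono) auto
    also have "\<dots> \<le> (\<Sum>i. emeasure lborel (ball (x i) (r i) \<inter> open_cube a l))"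
      by (intro emeasure_subadditive_countably) auto
    also have "\<dots> \<le> (\<Sum>i. ennreal c * ennreal (w * r i powr \<beta>))"
      by (intro suminf_le piece) auto
    also have "\<dots> = ennreal c * (\<Sum>i. ennreal (w * r i powr \<beta>))" by (rule ennreal_suminf_cmult)
    finally have "ennreal (1 / c) * emeasure lborel E \<le> ennreal (1 / c) * (ennreal c * (\<Sum>i. ennreal (w * r i powr \<beta>)))"
      by (intro mult_left_mono) auto
    also have "\<dots> = (\<Sum>i. ennreal (w * r i powr \<beta>))"
      using c by (simp add: mult.assoc[symmetric] ennreal_mult[symmetric])
    finally show ?thesis .
  qed
  have "ennreal (1 / c) * emeasure lborel E \<le> hausdorff_content \<beta> E"
    unfolding hausdorff_content_def
  proof (rule Inf_greatest)
    fix z assume "z \<in> {\<Sum>i. ennreal (unit_ball_vol \<beta> * r i powr \<beta>) |x r.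
        (\<forall>i::nat. 0 \<le> r i) \<and> E \<subseteq> (\<Union>i. ball (x i) (r i))}"
    then obtain x r where z: "z = (\<Sum>i. ennreal (w * r i powr \<beta>))" "\<forall>i::nat. 0 \<le> r i" "E \<subseteq> (\<Union>i. ball (x i) (r i))"
      by (auto simp: w_def)
    show "ennreal (1 / c) * emeasure lborel E \<le> z" unfolding z(1) by (rule main[OF z(2,3)])
  qed
  then show ?thesis unfolding c_def w_def V_def .
qed

lemma superlevel_measurable:
  fixes g :: "'a::euclidean_space \<Rightarrow> ennreal"
  assumes [measurable]: "g \<in> borel_measurable borel" "Q \<in> sets borel"
  shows "(\<lambda>t. emeasure lborel {x\<in>Q. ennreal t < g x}) \<in> borel_measurable borel"
proof -
  have "(\<lambda>t. \<integral>\<^sup>+ x. indicator {p. snd p \<in> Q \<and> ennreal (fst p) < g (snd p)} (t, x) \<partial>lborel) \<in> borel_measurable (borel :: real measure)"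
    by measurable
  moreover have "(\<integral>\<^sup>+ x. indicator {p. snd p \<in> Q \<and> ennreal (fst p) < g (snd p)} (t, x) \<partial>lborel)
      = emeasure lborel {x\<in>Q. ennreal t < g x}" for t
  proof -
    have "(\<integral>\<^sup>+ x. indicator {p. snd p \<in> Q \<and> ennreal (fst p) < g (snd p)} (t, x) \<partial>lborel)
      = (\<integral>\<^sup>+ x. indicator {x\<in>Q. ennreal t < g x} x \<partial>lborel)"
      by (intro nn_integral_cong) (auto simp: indicator_def)
    then show ?thesis by simp
  qed
  ultimately show ?thesis by simp
qed

lemma nn_integral_le_choquet:
  fixes g :: "'a::euclidean_space \<Rightarrow> ennreal"
  assumes g [measurable]: "g \<in> borel_measurable borel"
    and \<beta>: "0 < \<beta>" "\<beta> \<le> real DIM('a)" and l: "0 < l"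
  shows "(\<integral>\<^sup>+ x \<in> open_cube a l. g x \<partial>lborel)
    \<le> ennreal ((1 + unit_ball_vol (real DIM('a))) / unit_ball_vol \<beta> * l powr (real DIM('a) - \<beta>))
       * choquet_integral \<beta> (open_cube a l) g"
proof (rule ennreal_le_of_inverse_mult_le)
  let ?c = "(1 + unit_ball_vol (real DIM('a))) / unit_ball_vol \<beta> * l powr (real DIM('a) - \<beta>)"
  show "0 < ?c"
    using unit_ball_vol_pos[of \<beta>] unit_ball_vol_pos[of "real DIM('a)"] \<beta> l
    by (intro mult_pos_pos divide_pos_pos add_pos_pos) auto
  note [measurable] = superlevel_measurable
  have "ennreal (1 / ?c) * (\<integral>\<^sup>+ x \<in> open_cube a l. g x \<partial>lborel)
     = ennreal (1 / ?c) * (\<integral>\<^sup>+ t \<in> {0<..}. emeasure lborel {x\<in>open_cube a l. ennreal t < g x} \<partial>lborel)"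
    by (simp only: nn_integral_layer_cake[OF g open_cube_measurable])
  also have "\<dots> = (\<integral>\<^sup>+ t. ennreal (1 / ?c) * (emeasure lborel {x\<in>open_cube a l. ennreal t < g x} * indicator {0<..} t) \<partial>lborel)"
    by (rule nn_integral_cmult[symmetric]) measurable
  also have "\<dots> \<le> choquet_integral \<beta> (open_cube a l) g"
    unfolding choquet_integral_def
  proof (rule nn_integral_mono)
    fix t :: real
    show "ennreal (1 / ?c) * (emeasure lborel {x\<in>open_cube a l. ennreal t < g x} * indicator {0<..} t)
      \<le> hausdorff_content \<beta> {x\<in>open_cube a l. ennreal t < g x} * indicator {0<..} t"
      using emeasure_le_content[OF \<beta> l, of "{x\<in>open_cube a l. ennreal t < g x}" a]
      by (auto simp: indicator_def)
  qed
  finally show "ennreal (1 / ?c) * (\<integral>\<^sup>+ x \<in> open_cube a l. g x \<partial>lborel) \<le> choquet_integral \<beta> (open_cube a l) g" .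
qed

lemma BMO_norm_le_content_norm:
  fixes v :: "'a::euclidean_space \<Rightarrow> ennreal"
  assumes v [measurable]: "v \<in> borel_measurable borel"
    and \<beta>: "0 < \<beta>" "\<beta> \<le> real DIM('a)"
  shows "BMO_norm (\<lambda>x. enn2ereal (v x))
    \<le> ennreal ((1 + unit_ball_vol (real DIM('a))) / unit_ball_vol \<beta>) * BMO_content_norm \<beta> (\<lambda>x. enn2ereal (v x))"
  unfolding BMO_norm_def
proof (intro SUP_least)
  fix a :: 'a and l :: real assume "l \<in> {0<..}"
  then have l: "0 < l" by simp
  define C where "C = (1 + unit_ball_vol (real DIM('a))) / unit_ball_vol \<beta>"
  have C: "0 < C" using unit_ball_vol_pos[of \<beta>] unit_ball_vol_pos[of "real DIM('a)"] \<beta>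
    unfolding C_def by (intro divide_pos_pos add_pos_pos) auto
  let ?X = "\<lambda>c::real. (\<integral>\<^sup>+ x \<in> open_cube a l. e2ennreal \<bar>enn2ereal (v x) - ereal c\<bar> \<partial>lebesgue) / ennreal (l ^ DIM('a))"
  let ?Y = "\<lambda>c::real. choquet_integral \<beta> (open_cube a l) (\<lambda>x. e2ennreal \<bar>enn2ereal (v x) - ereal c\<bar>) / ennreal (l powr \<beta>)"
  have XY: "?X c \<le> ennreal C * ?Y c" for c
  proof -
    let ?Z = "choquet_integral \<beta> (open_cube a l) (\<lambda>x. e2ennreal \<bar>enn2ereal (v x) - ereal c\<bar>)"
    have "(\<integral>\<^sup>+ x \<in> open_cube a l. e2ennreal \<bar>enn2ereal (v x) - ereal c\<bar> \<partial>lebesgue)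
      \<le> ennreal (C * l powr (real DIM('a) - \<beta>)) * ?Z"
      unfolding nn_integral_completion C_def by (rule nn_integral_le_choquet[OF _ \<beta> l]) measurable
    then have "?X c \<le> ennreal (C * l powr (real DIM('a) - \<beta>)) * ?Z / ennreal (l ^ DIM('a))"
      by (rule divide_right_mono_ennreal)
    also have "\<dots> = ennreal (C * l powr (real DIM('a) - \<beta>)) * inverse (ennreal (l ^ DIM('a))) * ?Z"
      by (simp add: divide_ennreal_def mult_ac)
    also have "ennreal (C * l powr (real DIM('a) - \<beta>)) * inverse (ennreal (l ^ DIM('a)))
        = ennreal C * inverse (ennreal (l powr \<beta>))"
    proof -
      have "l powr (real DIM('a) - \<beta>) * inverse (l ^ DIM('a)) = inverse (l powr \<beta>)"
        using l by (simp add: powr_diff powr_realpow divide_inverse)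
      then show ?thesis using C l
        by (simp add: inverse_ennreal ennreal_mult[symmetric] mult.assoc)
    qed
    finally show ?thesis by (simp add: divide_ennreal_def mult_ac)
  qed
  have "ennreal (1 / C) * (INF c. ?X c) \<le> (INF c. ?Y c)"
  proof (rule INF_greatest)
    fix c :: real
    have "ennreal (1 / C) * (INF c. ?X c) \<le> ennreal (1 / C) * (ennreal C * ?Y c)"
      using XY[of c] by (intro mult_left_mono order_trans[OF INF_lower[of c]]) auto
    also have "\<dots> = ?Y c" using C by (simp add: mult.assoc[symmetric] ennreal_mult[symmetric])
    finally show "ennreal (1 / C) * (INF c. ?X c) \<le> ?Y c" .
  qed
  also have "(INF c. ?Y c) \<le> BMO_content_norm \<beta> (\<lambda>x. enn2ereal (v x))"
    unfolding BMO_content_norm_def using l by (intro SUP_upper2[of a] SUP_upper2[of l]) auto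
  finally show "(INF c. ?X c) \<le> ennreal ((1 + unit_ball_vol (real DIM('a))) / unit_ball_vol \<beta>)
      * BMO_content_norm \<beta> (\<lambda>x. enn2ereal (v x))"
    using C unfolding C_def[symmetric] by (intro ennreal_le_of_inverse_mult_le)
qed

lemma L1_loc_of_content:
  fixes v :: "'a::euclidean_space \<Rightarrow> ennreal"
  assumes v [measurable]: "v \<in> borel_measurable borel"
    and \<beta>: "0 < \<beta>" "\<beta> \<le> real DIM('a)"
    and L: "(\<lambda>x. enn2ereal (v x)) \<in> L1_loc_content \<beta>"
  shows "(\<lambda>x. enn2ereal (v x)) \<in> L1_loc"
  unfolding L1_loc_def mem_Collect_eq
proof (intro conjI allI impI)
  show "(\<lambda>x. enn2ereal (v x)) \<in> borel_measurable lebesgue"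
    by (intro measurable_completion) measurable
  fix K :: "'a set" assume "compact K"
  then obtain a l where l: "0 < l" "K \<subseteq> open_cube a l"
    using bounded_subset_open_cube compact_imp_bounded by metis
  have "(\<integral>\<^sup>+ x \<in> K. e2ennreal \<bar>enn2ereal (v x)\<bar> \<partial>lebesgue)
     \<le> (\<integral>\<^sup>+ x \<in> open_cube a l. e2ennreal \<bar>enn2ereal (v x)\<bar> \<partial>lborel)"
    unfolding nn_integral_completion using l(2) by (intro nn_integral_mono) (auto simp: indicator_def)
  also have "\<dots> \<le> ennreal ((1 + unit_ball_vol (real DIM('a))) / unit_ball_vol \<beta> * l powr (real DIM('a) - \<beta>))
       * choquet_integral \<beta> (open_cube a l) (\<lambda>x. e2ennreal \<bar>enn2ereal (v x)\<bar>)"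
    by (rule nn_integral_le_choquet[OF _ \<beta> l(1)]) measurable
  also have "\<dots> < \<infinity>"
    using L l(1) unfolding L1_loc_content_def L1_content_def by (auto simp: ennreal_mult_less_top)
  finally show "(\<integral>\<^sup>+ x \<in> K. e2ennreal \<bar>enn2ereal (v x)\<bar> \<partial>lebesgue) < \<infinity>" .
qed

section \<open>Integrals of the kernel against measures of controlled growth\<close>

text \<open>
  The mean value theorem, in a one-sided form that remains valid when the difference of the powers
  has the favourable sign.
\<close>

lemma powr_neg_diff_le:
  fixes p q m \<theta> :: real
  assumes "0 < m" "m \<le> p" "m \<le> q" "0 < \<theta>"
  shows "p powr -\<theta> \<le> q powr -\<theta> + \<theta> * m powr (-\<theta>-1) * \<bar>p - q\<bar>"
proof (cases "p < q")
  case False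
  then have "p powr -\<theta> \<le> q powr -\<theta>" using assms by (intro powr_mono2') auto
  moreover have "0 \<le> \<theta> * m powr (-\<theta>-1) * \<bar>p - q\<bar>" using assms by simp
  ultimately show ?thesis by linarith
next
  case True
  have "\<exists>\<xi>>p. \<xi> < q \<and> q powr -\<theta> - p powr -\<theta> = (q - p) * (-\<theta> * \<xi> powr (-\<theta>-1))"
  proof (rule MVT2[OF True])
    fix x assume "p \<le> x" "x \<le> q"
    then show "((\<lambda>x. x powr -\<theta>) has_real_derivative -\<theta> * x powr (-\<theta>-1)) (at x)"
      using assms by (auto intro!: derivative_eq_intros)
  qed
  then obtain \<xi> where \<xi>: "p < \<xi>" "\<xi> < q"
    "q powr -\<theta> - p powr -\<theta> = (q - p) * (-\<theta> * \<xi> powr (-\<theta>-1))" by blast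
  have "\<xi> powr (-\<theta>-1) \<le> m powr (-\<theta>-1)" using assms \<xi> by (intro powr_mono2') auto
  then have "(q - p) * (\<theta> * \<xi> powr (-\<theta>-1)) \<le> (q - p) * (\<theta> * m powr (-\<theta>-1))"
    using True assms by (intro mult_left_mono) auto
  with \<xi>(3) True show ?thesis by (simp add: algebra_simps)
qed

text \<open>
  On the dyadic shell of radius \<open>L / 2 ^ j\<close> the kernel is of order \<open>(L / 2 ^ j) powr -\<theta>\<close>. Growth of
  order \<open>\<sigma> > \<theta>\<close> makes the contributions of the shells a convergent geometric series.
\<close>

lemma nn_integral_kernel_ball_le:
  fixes N :: "'a::euclidean_space measure"
  assumes N: "sets N = sets borel" and \<theta>: "0 < \<theta>" "\<theta> < \<sigma>" and L: "0 < L" and D: "0 \<le> D"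
    and growth: "\<And>r. 0 < r \<Longrightarrow> r \<le> L \<Longrightarrow> emeasure N (ball x r) \<le> ennreal (D * r powr \<sigma>)"
  shows "(\<integral>\<^sup>+ y \<in> ball x L. ennreal (dist x y powr -\<theta>) \<partial>N)
         \<le> ennreal (2 powr \<theta> / (1 - 2 powr (\<theta> - \<sigma>)) * D * L powr (\<sigma> - \<theta>))"
proof -
  define \<rho> where "\<rho> j = L / 2 ^ j" for j :: nat
  have \<rho>: "0 < \<rho> j" "\<rho> j \<le> L" for j
    using L by (auto simp: \<rho>_def field_simps mult_le_cancel_left1)
  note [measurable_cong] = N
  have "(\<integral>\<^sup>+ y \<in> ball x L. ennreal (dist x y powr -\<theta>) \<partial>N)
     \<le> (\<integral>\<^sup>+ y. (\<Sum>j. ennreal (\<rho> (Suc j) powr -\<theta>) * indicator (ball x (\<rho> j)) y) \<partial>N)"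
  proof (rule nn_integral_mono)
    fix y
    show "ennreal (dist x y powr -\<theta>) * indicator (ball x L) y
      \<le> (\<Sum>j. ennreal (\<rho> (Suc j) powr -\<theta>) * indicator (ball x (\<rho> j)) y)"
    proof (cases "y \<in> ball x L \<and> y \<noteq> x")
      case False
      then show ?thesis by (auto simp: indicator_def)
    next
      case True
      then have d: "0 < dist x y" "dist x y < L" by (auto simp: dist_commute)
      have ex: "\<exists>j. \<rho> (Suc j) \<le> dist x y"
      proof -
        obtain j where "L / dist x y < 2 ^ j" using real_arch_pow[of 2 "L / dist x y"] by auto
        then have "L < dist x y * 2 ^ j" using d by (simp add: field_simps)
        also have "\<dots> \<le> dist x y * 2 ^ Suc j" using d by (intro mult_left_mono) auto
        finally have "\<rho> (Suc j) \<le> dist x y" by (simp add: \<rho>_def field_simps)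
        then show ?thesis ..
      qed
      define j where "j = (LEAST j. \<rho> (Suc j) \<le> dist x y)"
      have j1: "\<rho> (Suc j) \<le> dist x y" unfolding j_def using ex by (rule LeastI_ex)
      have j2: "dist x y < \<rho> j"
      proof (cases j)
        case 0 then show ?thesis using d by (simp add: \<rho>_def)
      next
        case (Suc k)
        then have "\<not> \<rho> (Suc k) \<le> dist x y" using not_less_Least[of k "\<lambda>j. \<rho> (Suc j) \<le> dist x y"]
          by (auto simp: j_def)
        then show ?thesis using Suc by simp
      qed
      have "ennreal (dist x y powr -\<theta>) * indicator (ball x L) y
         \<le> ennreal (\<rho> (Suc j) powr -\<theta>) * indicator (ball x (\<rho> j)) y"
        using j1 j2 \<rho>(1)[of "Suc j"] \<theta> d by (auto simp: indicator_def intro!: ennreal_leI powr_mono2')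
      also have "\<dots> \<le> (\<Sum>k. ennreal (\<rho> (Suc k) powr -\<theta>) * indicator (ball x (\<rho> k)) y)"
        using ennreal_le_suminf[of "\<lambda>k. ennreal (\<rho> (Suc k) powr -\<theta>) * indicator (ball x (\<rho> k)) y" j] .
      finally show ?thesis .
    qed
  qed
  also have "\<dots> = (\<Sum>j. \<integral>\<^sup>+ y. ennreal (\<rho> (Suc j) powr -\<theta>) * indicator (ball x (\<rho> j)) y \<partial>N)"
    by (rule nn_integral_suminf) measurable
  also have "\<dots> = (\<Sum>j. ennreal (\<rho> (Suc j) powr -\<theta>) * emeasure N (ball x (\<rho> j)))"
    by (intro suminf_cong nn_integral_cmult_indicator) (simp add: N)
  also have "\<dots> \<le> (\<Sum>j. ennreal (2 powr \<theta> * D * L powr (\<sigma> - \<theta>) * (2 powr (\<theta> - \<sigma>)) ^ j))"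
  proof (intro suminf_le)
    fix j
    have "ennreal (\<rho> (Suc j) powr -\<theta>) * emeasure N (ball x (\<rho> j))
       \<le> ennreal (\<rho> (Suc j) powr -\<theta>) * ennreal (D * \<rho> j powr \<sigma>)"
      using \<rho> by (intro mult_left_mono growth) auto
    also have "\<dots> = ennreal (\<rho> (Suc j) powr -\<theta> * (D * \<rho> j powr \<sigma>))"
      using D by (subst ennreal_mult) auto
    also have "\<rho> (Suc j) powr -\<theta> * (D * \<rho> j powr \<sigma>)
        = 2 powr \<theta> * D * L powr (\<sigma> - \<theta>) * (2 powr (\<theta> - \<sigma>)) ^ j"
    proof -
      have half: "\<rho> (Suc j) = \<rho> j / 2" by (simp add: \<rho>_def)
      have "\<rho> (Suc j) powr -\<theta> = \<rho> j powr -\<theta> * 2 powr \<theta>"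
        unfolding half powr_divide by (simp add: powr_minus_divide)
      moreover have "\<rho> j powr -\<theta> * \<rho> j powr \<sigma> = \<rho> j powr (\<sigma> - \<theta>)"
        using \<rho>(1)[of j] by (simp add: powr_add[symmetric])
      moreover have "\<rho> j powr (\<sigma> - \<theta>) = L powr (\<sigma> - \<theta>) * (2 powr (\<theta> - \<sigma>)) ^ j"
      proof -
        have "\<rho> j = L * 2 powr (- real j)" using L by (simp add: \<rho>_def powr_minus powr_realpow divide_inverse)
        then have "\<rho> j powr (\<sigma> - \<theta>) = L powr (\<sigma> - \<theta>) * (2 powr (- real j)) powr (\<sigma> - \<theta>)"
          using L by (simp add: powr_mult)
        also have "(2 powr (- real j)) powr (\<sigma> - \<theta>) = (2 powr (\<theta> - \<sigma>)) powr real j"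
          by (simp add: powr_powr algebra_simps)
        also have "\<dots> = (2 powr (\<theta> - \<sigma>)) ^ j" by (simp add: powr_realpow)
        finally show ?thesis .
      qed
      ultimately show ?thesis by (simp add: mult_ac)
    qed
    finally show "ennreal (\<rho> (Suc j) powr -\<theta>) * emeasure N (ball x (\<rho> j))
      \<le> ennreal (2 powr \<theta> * D * L powr (\<sigma> - \<theta>) * (2 powr (\<theta> - \<sigma>)) ^ j)" .
  qed auto
  also have "\<dots> = ennreal (\<Sum>j. 2 powr \<theta> * D * L powr (\<sigma> - \<theta>) * (2 powr (\<theta> - \<sigma>)) ^ j)"
  proof (rule suminf_ennreal2)
    have "2 powr (\<theta> - \<sigma>) < 1" using \<theta> by (simp add: powr_less_one)
    then show "summable (\<lambda>j. 2 powr \<theta> * D * L powr (\<sigma> - \<theta>) * (2 powr (\<theta> - \<sigma>)) ^ j)"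
      by (intro summable_mult summable_geometric) simp
  qed (use D in simp)
  also have "(\<Sum>j. 2 powr \<theta> * D * L powr (\<sigma> - \<theta>) * (2 powr (\<theta> - \<sigma>)) ^ j)
      = 2 powr \<theta> / (1 - 2 powr (\<theta> - \<sigma>)) * D * L powr (\<sigma> - \<theta>)"
  proof -
    have "2 powr (\<theta> - \<sigma>) < 1" using \<theta> by (simp add: powr_less_one)
    then show ?thesis by (subst suminf_mult) (auto simp: suminf_geometric)
  qed
  finally show ?thesis .
qed

text \<open>
  At infinity one extra power of the distance makes the dyadic series converge under growth of the
  critical order \<open>\<theta>\<close>. Up to a constant, the integrand dominates the gradient of \<open>dist x y powr -\<theta>\<close>
  in \<open>x\<close> for \<open>x\<close> near \<open>a\<close> and \<open>y\<close> far away.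
\<close>

lemma nn_integral_tail_le:
  fixes N :: "'a::euclidean_space measure"
  assumes N: "sets N = sets borel" and \<theta>: "0 < \<theta>" and d: "0 < d" and M: "0 \<le> M"
    and growth: "\<And>r. 0 < r \<Longrightarrow> emeasure N (ball a r) \<le> ennreal (M * r powr \<theta>)"
  shows "(\<integral>\<^sup>+ y. ennreal (max (dist a y) d powr (-\<theta>-1)) \<partial>N) \<le> ennreal (2 powr (\<theta> + 1) * M / d)"
proof -
  note [measurable_cong] = N
  have "(\<integral>\<^sup>+ y. ennreal (max (dist a y) d powr (-\<theta>-1)) \<partial>N)
     \<le> (\<integral>\<^sup>+ y. (\<Sum>j. ennreal ((2 ^ j * d) powr (-\<theta>-1)) * indicator (ball a (2 ^ Suc j * d)) y) \<partial>N)"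
  proof (rule nn_integral_mono)
    fix y
    have ex: "\<exists>j. dist a y < 2 ^ Suc j * d"
    proof -
      obtain j where "dist a y / d < 2 ^ j" using real_arch_pow[of 2 "dist a y / d"] by auto
      then have "dist a y < 2 ^ j * d" using d by (simp add: field_simps)
      also have "\<dots> \<le> 2 ^ Suc j * d" using d by (intro mult_right_mono) auto
      finally show ?thesis ..
    qed
    define j where "j = (LEAST j. dist a y < 2 ^ Suc j * d)"
    have j1: "dist a y < 2 ^ Suc j * d" unfolding j_def using ex by (rule LeastI_ex)
    have j2: "2 ^ j * d \<le> max (dist a y) d"
    proof (cases j)
      case (Suc k)
      then have "\<not> dist a y < 2 ^ Suc k * d"
        using not_less_Least[of k "\<lambda>j. dist a y < 2 ^ Suc j * d"] by (auto simp: j_def)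
      then show ?thesis using Suc by simp
    qed simp
    have "ennreal (max (dist a y) d powr (-\<theta>-1))
       \<le> ennreal ((2 ^ j * d) powr (-\<theta>-1)) * indicator (ball a (2 ^ Suc j * d)) y"
      using j1 j2 d \<theta> by (auto simp: indicator_def intro!: ennreal_leI powr_mono2')
    also have "\<dots> \<le> (\<Sum>j. ennreal ((2 ^ j * d) powr (-\<theta>-1)) * indicator (ball a (2 ^ Suc j * d)) y)"
      using ennreal_le_suminf[of "\<lambda>j. ennreal ((2 ^ j * d) powr (-\<theta>-1)) * indicator (ball a (2 ^ Suc j * d)) y" j] .
    finally show "ennreal (max (dist a y) d powr (-\<theta>-1)) \<le> \<dots>" .
  qed
  also have "\<dots> = (\<Sum>j. \<integral>\<^sup>+ y. ennreal ((2 ^ j * d) powr (-\<theta>-1)) * indicator (ball a (2 ^ Suc j * d)) y \<partial>N)"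
    by (rule nn_integral_suminf) measurable
  also have "\<dots> = (\<Sum>j. ennreal ((2 ^ j * d) powr (-\<theta>-1)) * emeasure N (ball a (2 ^ Suc j * d)))"
    by (intro suminf_cong nn_integral_cmult_indicator) (simp add: N)
  also have "\<dots> \<le> (\<Sum>j. ennreal (2 powr \<theta> * M / d * (1/2) ^ j))"
  proof (intro suminf_le)
    fix j
    have "ennreal ((2 ^ j * d) powr (-\<theta>-1)) * emeasure N (ball a (2 ^ Suc j * d))
       \<le> ennreal ((2 ^ j * d) powr (-\<theta>-1)) * ennreal (M * (2 ^ Suc j * d) powr \<theta>)"
      using d by (intro mult_left_mono growth) auto
    also have "\<dots> = ennreal ((2 ^ j * d) powr (-\<theta>-1) * (M * (2 ^ Suc j * d) powr \<theta>))"
      using M by (subst ennreal_mult) auto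
    also have "(2 ^ j * d) powr (-\<theta>-1) * (M * (2 ^ Suc j * d) powr \<theta>) = 2 powr \<theta> * M / d * (1/2) ^ j"
    proof -
      define e where "e = 2 ^ j * d"
      have e: "0 < e" using d by (simp add: e_def)
      have "(2 ^ Suc j * d) powr \<theta> = 2 powr \<theta> * e powr \<theta>"
        using e by (simp add: e_def powr_mult mult.assoc)
      moreover have "e powr (-\<theta>-1) * e powr \<theta> = 1 / e"
        using e by (simp add: powr_add[symmetric] powr_minus divide_inverse)
      ultimately show ?thesis unfolding e_def[symmetric] 
        by (simp add: e_def power_divide field_simps)
    qed
    finally show "ennreal ((2 ^ j * d) powr (-\<theta>-1)) * emeasure N (ball a (2 ^ Suc j * d))
       \<le> ennreal (2 powr \<theta> * M / d * (1/2) ^ j)" .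
  qed auto
  also have "\<dots> = ennreal (\<Sum>j. 2 powr \<theta> * M / d * (1/2) ^ j)"
    using M d by (intro suminf_ennreal2 summable_mult summable_geometric) auto
  also have "(\<Sum>j. 2 powr \<theta> * M / d * (1/2) ^ j) = 2 powr (\<theta> + 1) * M / d"
    by (subst suminf_mult) (auto simp: suminf_geometric powr_add)
  finally show ?thesis .
qed

definition truncated_potential :: "real \<Rightarrow> real \<Rightarrow> 'a::euclidean_space measure \<Rightarrow> 'a \<Rightarrow> ennreal" where
  "truncated_potential \<theta> \<rho> N x = (\<integral>\<^sup>+ y. ennreal (max (dist x y) \<rho> powr -\<theta>) \<partial>N)"

definition potential :: "real \<Rightarrow> 'a::euclidean_space measure \<Rightarrow> 'a \<Rightarrow> ennreal" where
  "potential \<theta> N x = (\<integral>\<^sup>+ y. ennreal (dist x y powr -\<theta>) \<partial>N)"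

text \<open>
  The derivative of the frozen kernel at distance \<open>p\<close> is at most \<open>\<theta> * (max p \<rho>) powr (-\<theta>-1)\<close>.
  For all points of \<open>cball a d\<close> the quantity \<open>max p \<rho>\<close> is bounded below by the fixed multiple
  \<open>\<rho> / (2 * d)\<close> of \<open>max (dist a y) d\<close>, which reduces the claim to the tail integral around \<open>a\<close>.
\<close>

lemma truncated_potential_lipschitz:
  fixes N :: "'a::euclidean_space measure"
  assumes N: "sets N = sets borel" and \<theta>: "0 < \<theta>" and \<rho>: "0 < \<rho>" "\<rho> \<le> d" and M: "0 \<le> M"
    and growth: "\<And>r. 0 < r \<Longrightarrow> emeasure N (ball a r) \<le> ennreal (M * r powr \<theta>)"
    and x: "x \<in> cball a d" "x' \<in> cball a d"
  shows "truncated_potential \<theta> \<rho> N x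
    \<le> truncated_potential \<theta> \<rho> N x' + ennreal (\<theta> * 4 powr (\<theta> + 1) * (d / \<rho>) powr (\<theta> + 1) * M / d * dist x x')"
proof -
  note [measurable_cong] = N
  define K where "K = \<theta> * (\<rho> / (2 * d)) powr (-\<theta>-1) * dist x x'"
  have K0: "0 \<le> K" using \<theta> by (simp add: K_def)
  have pw: "max (dist x y) \<rho> powr -\<theta> \<le> max (dist x' y) \<rho> powr -\<theta> + K * max (dist a y) d powr (-\<theta>-1)" for y
  proof -
    define m where "m = \<rho> / (2 * d) * max (dist a y) d"
    have m0: "0 < m" using \<rho> by (simp add: m_def less_max_iff_disj)
    have m: "m \<le> max (dist z y) \<rho>" if "z \<in> cball a d" for z
    proof (cases "dist a y \<le> 2 * d")
      case True
      then have "m \<le> \<rho> / (2 * d) * (2 * d)" unfolding m_def using \<rho> by (intro mult_left_mono) auto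
      then show ?thesis using \<rho> by simp
    next
      case False
      have "dist a y / 2 \<le> dist z y"
        using dist_triangle[of a y z] that False by (simp add: dist_commute)
      moreover have "m = (\<rho> / d) * (dist a y / 2)" using False \<rho> by (simp add: m_def)
      moreover have "(\<rho> / d) * (dist a y / 2) \<le> 1 * (dist a y / 2)" using \<rho> by (intro mult_right_mono) auto
      ultimately show ?thesis by simp
    qed
    have "max (dist x y) \<rho> powr -\<theta> \<le> max (dist x' y) \<rho> powr -\<theta>
        + \<theta> * m powr (-\<theta>-1) * \<bar>max (dist x y) \<rho> - max (dist x' y) \<rho>\<bar>"
      using m0 m x \<theta> by (intro powr_neg_diff_le) auto
    also have "\<theta> * m powr (-\<theta>-1) * \<bar>max (dist x y) \<rho> - max (dist x' y) \<rho>\<bar> \<le> \<theta> * m powr (-\<theta>-1) * dist x x'"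
    proof (intro mult_left_mono)
      have "\<bar>dist x y - dist x' y\<bar> \<le> dist x x'"
        using dist_triangle[of x y x'] dist_triangle[of x' y x] by (simp add: dist_commute)
      then show "\<bar>max (dist x y) \<rho> - max (dist x' y) \<rho>\<bar> \<le> dist x x'" by (auto simp: max_def)
    qed (use \<theta> in auto)
    also have "\<theta> * m powr (-\<theta>-1) * dist x x' = K * max (dist a y) d powr (-\<theta>-1)"
    proof -
      have "m powr (-\<theta>-1) = (\<rho> / (2 * d)) powr (-\<theta>-1) * max (dist a y) d powr (-\<theta>-1)"
        unfolding m_def by (rule powr_mult)
      then show ?thesis by (simp add: K_def)
    qed
    finally show ?thesis by simp
  qed
  have "truncated_potential \<theta> \<rho> N x \<le>
    (\<integral>\<^sup>+ y. ennreal (max (dist x' y) \<rho> powr -\<theta>) + ennreal K * ennreal (max (dist a y) d powr (-\<theta>-1)) \<partial>N)"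
    unfolding truncated_potential_def
  proof (rule nn_integral_mono)
    fix y
    show "ennreal (max (dist x y) \<rho> powr -\<theta>)
      \<le> ennreal (max (dist x' y) \<rho> powr -\<theta>) + ennreal K * ennreal (max (dist a y) d powr (-\<theta>-1))"
      using pw[of y] K0 by (simp add: ennreal_mult[symmetric] ennreal_plus[symmetric] del: ennreal_plus)
  qed
  also have "\<dots> = truncated_potential \<theta> \<rho> N x'
      + ennreal K * (\<integral>\<^sup>+ y. ennreal (max (dist a y) d powr (-\<theta>-1)) \<partial>N)"
    unfolding truncated_potential_def
    by (subst nn_integral_add) (measurable, simp add: nn_integral_cmult)
  also have "\<dots> \<le> truncated_potential \<theta> \<rho> N x' + ennreal K * ennreal (2 powr (\<theta> + 1) * M / d)"
    using N \<theta> \<rho> M growth by (intro add_left_mono mult_left_mono nn_integral_tail_le) auto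
  also have "ennreal K * ennreal (2 powr (\<theta> + 1) * M / d)
     = ennreal (\<theta> * 4 powr (\<theta> + 1) * (d / \<rho>) powr (\<theta> + 1) * M / d * dist x x')"
  proof -
    have "(\<rho> / (2 * d)) powr (-\<theta>-1) = (2 * (d / \<rho>)) powr (\<theta> + 1)"
      using \<rho> powr_minus_divide[of "\<rho> / (2 * d)" "\<theta> + 1"] by (simp add: powr_divide)
    also have "\<dots> = 2 powr (\<theta> + 1) * (d / \<rho>) powr (\<theta> + 1)" using \<rho> by (subst powr_mult) auto
    finally have e: "(\<rho> / (2 * d)) powr (-\<theta>-1) = 2 powr (\<theta> + 1) * (d / \<rho>) powr (\<theta> + 1)" .
    have f: "(4::real) powr (\<theta> + 1) = 2 powr (\<theta> + 1) * 2 powr (\<theta> + 1)"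
      by (subst powr_mult[symmetric]) auto
    have "ennreal K * ennreal (2 powr (\<theta> + 1) * M / d) = ennreal (K * (2 powr (\<theta> + 1) * M / d))"
      using K0 M \<rho> by (subst ennreal_mult) auto
    also have "K * (2 powr (\<theta> + 1) * M / d)
      = \<theta> * 4 powr (\<theta> + 1) * (d / \<rho>) powr (\<theta> + 1) * M / d * dist x x'"
      unfolding K_def e f by simp
    finally show ?thesis .
  qed
  finally show ?thesis .
qed

lemma potential_le_truncated:
  fixes N :: "'a::euclidean_space measure"
  assumes N: "sets N = sets borel"
  shows "potential \<theta> N x
    \<le> truncated_potential \<theta> \<rho> N x + (\<integral>\<^sup>+ y \<in> ball x \<rho>. ennreal (dist x y powr -\<theta>) \<partial>N)"
proof -
  note [measurable_cong] = N
  have "potential \<theta> N x \<le> (\<integral>\<^sup>+ y. ennreal (max (dist x y) \<rho> powr -\<theta>)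
      + ennreal (dist x y powr -\<theta>) * indicator (ball x \<rho>) y \<partial>N)"
    unfolding potential_def by (intro nn_integral_mono) (auto simp: indicator_def max_def)
  also have "\<dots> = truncated_potential \<theta> \<rho> N x + (\<integral>\<^sup>+ y \<in> ball x \<rho>. ennreal (dist x y powr -\<theta>) \<partial>N)"
    unfolding truncated_potential_def
    by (rule nn_integral_add) measurable
  finally show ?thesis .
qed

text \<open>
  The kernels are ordered except at \<open>y = x\<close>, where \<open>0 powr -\<theta> = 0\<close>; hence the null point.
\<close>

lemma truncated_potential_le:
  fixes N :: "'a::euclidean_space measure"
  assumes N: "sets N = sets borel" and \<theta>: "0 < \<theta>" and x: "emeasure N {x} = 0"
  shows "truncated_potential \<theta> \<rho> N x \<le> potential \<theta> N x"
proof -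
  have "AE y in N. y \<noteq> x" using x by (intro AE_I[of _ _ "{x}"]) (auto simp: N)
  then show ?thesis unfolding potential_def truncated_potential_def
    using \<theta> by (intro nn_integral_mono_AE) (auto elim!: eventually_mono intro!: ennreal_leI powr_mono2')
qed

section \<open>Morrey growth implies bounded mean oscillation for the content\<close>

locale morrey_measure =
  fixes N :: "'a::euclidean_space measure" and \<theta> M :: real
  assumes sets_N: "sets N = sets borel"
    and \<theta>_pos: "0 < \<theta>" and M_pos: "0 < M"
    and growth: "\<And>x r. 0 < r \<Longrightarrow> emeasure N (ball x r) \<le> ennreal (M * r powr \<theta>)"
begin

definition local_potential :: "real \<Rightarrow> 'a \<Rightarrow> ennreal" where
  "local_potential \<rho> x = (\<integral>\<^sup>+ y \<in> ball x \<rho>. ennreal (dist x y powr -\<theta>) \<partial>N)"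

definition dense_points :: "real \<Rightarrow> real \<Rightarrow> real \<Rightarrow> 'a set" where
  "dense_points \<beta> s d = {x. \<exists>r. 0 < r \<and> r \<le> d \<and> ennreal (s * r powr \<beta>) < emeasure N (ball x r)}"

text \<open>
  The constant of \<open>nn_integral_kernel_ball_le\<close> for growth of order \<open>(\<theta> + \<beta>) / 2\<close>.
\<close>

definition local_const :: "real \<Rightarrow> real" where
  "local_const \<beta> = 2 powr \<theta> / (1 - 2 powr ((\<theta> - \<beta>) / 2))"

lemma emeasure_singleton: "emeasure N {x} = 0"
proof -
  have "emeasure N {x} \<le> 0"
  proof (rule LIMSEQ_le_const)
    have "(\<lambda>n. M * inverse (real (Suc n)) powr \<theta>) \<longlonglongrightarrow> M * 0 powr \<theta>"
      using \<theta>_pos by (intro tendsto_intros LIMSEQ_inverse_real_of_nat) auto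
    then have "(\<lambda>n. ennreal (M * inverse (real (Suc n)) powr \<theta>)) \<longlonglongrightarrow> ennreal (M * 0 powr \<theta>)"
      by (rule tendsto_ennrealI)
    then show "(\<lambda>n. ennreal (M * inverse (real (Suc n)) powr \<theta>)) \<longlonglongrightarrow> 0" by simp
    have "emeasure N {x} \<le> ennreal (M * inverse (real (Suc n)) powr \<theta>)" for n
    proof -
      have "emeasure N {x} \<le> emeasure N (ball x (inverse (real (Suc n))))"
        by (intro emeasure_mono) (auto simp: sets_N)
      also have "\<dots> \<le> ennreal (M * inverse (real (Suc n)) powr \<theta>)" by (intro growth) simp
      finally show ?thesis .
    qed
    then show "\<exists>n0. \<forall>n\<ge>n0. emeasure N {x} \<le> ennreal (M * inverse (real (Suc n)) powr \<theta>)" by blast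
  qed
  then show ?thesis by simp
qed

lemma local_const_pos: "\<theta> < \<beta> \<Longrightarrow> 0 < local_const \<beta>"
  unfolding local_const_def by (simp add: powr_less_one)

text \<open>
  For \<open>r \<le> d\<close> the measure of \<open>ball x r\<close> is below both \<open>M * r powr \<theta>\<close> and \<open>s * r powr \<beta>\<close>, hence below
  their geometric mean, whose order \<open>(\<theta> + \<beta>) / 2\<close> exceeds \<open>\<theta>\<close>.
\<close>

lemma local_potential_le:
  assumes \<beta>: "\<theta> < \<beta>" and \<rho>: "0 < \<rho>" "\<rho> \<le> d" and s: "0 < s" and x: "x \<notin> dense_points \<beta> s d"
  shows "local_potential \<rho> x \<le> ennreal (local_const \<beta> * sqrt (M * s) * \<rho> powr ((\<beta> - \<theta>) / 2))"
proof -
  define \<sigma> where "\<sigma> = (\<theta> + \<beta>) / 2"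
  have \<sigma>: "\<theta> < \<sigma>" "\<theta> - \<sigma> = (\<theta> - \<beta>) / 2" "\<sigma> - \<theta> = (\<beta> - \<theta>) / 2"
    using \<beta> by (auto simp: \<sigma>_def field_simps)
  have "local_potential \<rho> x \<le> ennreal (2 powr \<theta> / (1 - 2 powr (\<theta> - \<sigma>)) * sqrt (M * s) * \<rho> powr (\<sigma> - \<theta>))"
    unfolding local_potential_def
  proof (rule nn_integral_kernel_ball_le)
    fix r assume r: "0 < r" "r \<le> \<rho>"
    then have "\<not> ennreal (s * r powr \<beta>) < emeasure N (ball x r)"
      using x \<rho> unfolding dense_points_def by auto
    then have 1: "emeasure N (ball x r) \<le> ennreal (s * r powr \<beta>)" by simp
    have 2: "emeasure N (ball x r) \<le> ennreal (M * r powr \<theta>)" using r growth by simp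
    define p q where "p = M * r powr \<theta>" and "q = s * r powr \<beta>"
    have pq: "0 \<le> p" "0 \<le> q" using s M_pos by (auto simp: p_def q_def)
    have "emeasure N (ball x r) \<le> ennreal (min p q)" using 1 2 by (auto simp: min_def p_def q_def)
    also have "\<dots> \<le> ennreal (sqrt (p * q))"
    proof (rule ennreal_leI, rule real_le_rsqrt)
      show "(min p q)\<^sup>2 \<le> p * q" unfolding power2_eq_square using pq by (intro mult_mono) auto
    qed
    also have "sqrt (p * q) = sqrt (M * s) * r powr \<sigma>"
    proof -
      have "p * q = (M * s) * (r powr \<theta> * r powr \<beta>)" by (simp add: p_def q_def)
      also have "r powr \<theta> * r powr \<beta> = (r powr \<sigma>)\<^sup>2"
      proof -
        have "\<theta> + \<beta> = \<sigma> + \<sigma>" by (simp add: \<sigma>_def)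
        then show ?thesis unfolding power2_eq_square powr_add[symmetric] by simp
      qed
      finally show ?thesis by (simp add: real_sqrt_mult)
    qed
    finally show "emeasure N (ball x r) \<le> ennreal (sqrt (M * s) * r powr \<sigma>)" .
  qed (use sets_N \<theta>_pos \<sigma> \<rho> M_pos s in auto)
  then show ?thesis unfolding local_const_def \<sigma> .
qed

lemma content_dense_points_le:
  assumes "0 \<le> \<beta>" "0 < d" "0 < s" "Q \<subseteq> ball a d"
  shows "hausdorff_content \<beta> (Q \<inter> dense_points \<beta> s d)
      \<le> ennreal (unit_ball_vol \<beta> * 5 powr \<beta> * 2 powr \<theta> * M * d powr \<theta> / s)"
proof -
  have "hausdorff_content \<beta> (Q \<inter> dense_points \<beta> s d)
     \<le> ennreal (unit_ball_vol \<beta> * 5 powr \<beta> / s) * emeasure N (ball a (2 * d))"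
    unfolding dense_points_def Int_def mem_Collect_eq
  proof (rule hausdorff_content_large_density)
    fix x assume "x \<in> Q"
    then have "dist a x < d" using assms by auto
    then have "dist a y < 2 * d" if "dist x y < d" for y
      using that dist_triangle[of a y x] by simp
    then show "ball x d \<subseteq> ball a (2 * d)" by auto
  qed (use assms sets_N in auto)
  also have "\<dots> \<le> ennreal (unit_ball_vol \<beta> * 5 powr \<beta> / s) * ennreal (M * (2 * d) powr \<theta>)"
    using assms by (intro mult_left_mono growth) auto
  also have "\<dots> = ennreal (unit_ball_vol \<beta> * 5 powr \<beta> / s * (M * (2 * d) powr \<theta>))"
    using assms M_pos unit_ball_vol_pos[of \<beta>] by (intro ennreal_mult[symmetric]) auto
  also have "unit_ball_vol \<beta> * 5 powr \<beta> / s * (M * (2 * d) powr \<theta>)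
     = unit_ball_vol \<beta> * 5 powr \<beta> * 2 powr \<theta> * M * d powr \<theta> / s"
    by (simp add: powr_mult)
  finally show ?thesis .
qed

text \<open>
  At level \<open>t\<close> the density threshold \<open>s\<close> is chosen so that the bound for the local potential at points
  that are not dense equals \<open>t - K\<close>; thus \<open>s\<close> is proportional to the square of \<open>t - K\<close>, and the
  superlevel set lies in the set of dense points, of content at most a constant over \<open>s\<close>.
\<close>

lemma choquet_integral_local_potential_le:
  assumes \<beta>: "\<theta> < \<beta>" and d: "0 < d" and Q: "Q \<subseteq> ball a d" and K: "0 \<le> K"
    and g: "\<And>x. x \<in> Q \<Longrightarrow> g x \<le> local_potential d x + ennreal K"
  shows "choquet_integral \<beta> Q g
    \<le> ennreal (unit_ball_vol \<beta> * d powr \<beta> * (K + M + 5 powr \<beta> * 2 powr \<theta> * (local_const \<beta>)\<^sup>2 * M))"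
proof -
  define c where "c = local_const \<beta>"
  have c: "0 < c" using local_const_pos[OF \<beta>] by (simp add: c_def)
  have \<beta>0: "0 \<le> \<beta>" using \<beta> \<theta>_pos by simp
  define B where "B = unit_ball_vol \<beta> * 5 powr \<beta> * 2 powr \<theta> * c\<^sup>2 * M\<^sup>2 * d powr \<beta>"
  have "choquet_integral \<beta> Q g \<le> ennreal (unit_ball_vol \<beta> * d powr \<beta> * (K + M) + B / M)"
  proof (rule choquet_integral_le)
    show "hausdorff_content \<beta> Q \<le> ennreal (unit_ball_vol \<beta> * d powr \<beta>)"
      using Q d by (intro hausdorff_content_subset_ball) auto
    fix t assume t: "K < t"
    define s where "s = (t - K)\<^sup>2 / (c\<^sup>2 * M * d powr (\<beta> - \<theta>))"
    have s: "0 < s" using t c d M_pos by (simp add: s_def)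
    have "{x\<in>Q. ennreal t < g x} \<subseteq> Q \<inter> dense_points \<beta> s d"
    proof
      fix x assume "x \<in> {x\<in>Q. ennreal t < g x}"
      then have x: "x \<in> Q" "ennreal t < g x" by auto
      show "x \<in> Q \<inter> dense_points \<beta> s d"
      proof (rule ccontr)
        assume "x \<notin> Q \<inter> dense_points \<beta> s d"
        then have "local_potential d x \<le> ennreal (c * sqrt (M * s) * d powr ((\<beta> - \<theta>) / 2))"
          unfolding c_def using x(1) \<beta> d s by (intro local_potential_le) auto
        also have "c * sqrt (M * s) * d powr ((\<beta> - \<theta>) / 2) = t - K"
        proof -
          have "d powr (\<beta> - \<theta>) = (d powr ((\<beta> - \<theta>) / 2))\<^sup>2"
            unfolding power2_eq_square by (simp add: powr_add[symmetric])
          then have "M * s = ((t - K) / (c * d powr ((\<beta> - \<theta>) / 2)))\<^sup>2"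
            using M_pos by (simp add: s_def power_mult_distrib power_divide)
          then have "sqrt (M * s) = (t - K) / (c * d powr ((\<beta> - \<theta>) / 2))"
            using t c by simp
          then show ?thesis using c d by simp
        qed
        finally have "g x \<le> ennreal (t - K) + ennreal K"
          by (intro order_trans[OF g[OF x(1)]] add_right_mono)
        also have "\<dots> = ennreal t" using t K by (simp flip: ennreal_plus)
        finally show False using x(2) by simp
      qed
    qed
    then have "hausdorff_content \<beta> {x\<in>Q. ennreal t < g x}
      \<le> ennreal (unit_ball_vol \<beta> * 5 powr \<beta> * 2 powr \<theta> * M * d powr \<theta> / s)"
      by (rule order_trans[OF hausdorff_content_mono content_dense_points_le[OF \<beta>0 d s Q]])
    also have "unit_ball_vol \<beta> * 5 powr \<beta> * 2 powr \<theta> * M * d powr \<theta> / s = B / (t - K)\<^sup>2"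
    proof -
      have "d powr \<theta> * d powr (\<beta> - \<theta>) = d powr \<beta>" by (simp add: powr_add[symmetric])
      then show ?thesis by (simp add: s_def B_def power2_eq_square mult_ac)
    qed
    finally show "hausdorff_content \<beta> {x\<in>Q. ennreal t < g x} \<le> ennreal (B / (t - K)\<^sup>2)" .
  qed (use K M_pos \<beta>0 in \<open>auto simp: B_def\<close>)
  also have "unit_ball_vol \<beta> * d powr \<beta> * (K + M) + B / M
    = unit_ball_vol \<beta> * d powr \<beta> * (K + M + 5 powr \<beta> * 2 powr \<theta> * c\<^sup>2 * M)"
    using M_pos by (simp add: B_def power2_eq_square algebra_simps)
  finally show ?thesis unfolding c_def .
qed

lemma truncated_lipschitz:
  assumes "0 < \<rho>" "\<rho> \<le> d" "x \<in> ball a d" "x' \<in> ball a d"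
  shows "truncated_potential \<theta> \<rho> N x
    \<le> truncated_potential \<theta> \<rho> N x' + ennreal (\<theta> * 4 powr (\<theta> + 1) * (d / \<rho>) powr (\<theta> + 1) * M / d * dist x x')"
  using assms sets_N \<theta>_pos M_pos growth by (intro truncated_potential_lipschitz[where a = a]) auto

text \<open>
  A potential that is finite at one point of the ball has finite truncations on the whole ball, since
  truncations vary by a finite amount there.
\<close>

lemma truncated_finite:
  assumes "0 < \<rho>" "\<rho> \<le> d" "x \<in> ball a d" "x' \<in> ball a d" "potential \<theta> N x' < top"
  shows "truncated_potential \<theta> \<rho> N x < top"
proof -
  have "truncated_potential \<theta> \<rho> N x' \<le> potential \<theta> N x'"
    by (rule truncated_potential_le[OF sets_N \<theta>_pos emeasure_singleton])
  then have "truncated_potential \<theta> \<rho> N x' < top" using assms(5) by (rule le_less_trans)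
  then show ?thesis
    by (intro le_less_trans[OF truncated_lipschitz[OF assms(1-4)]]) simp
qed

lemma truncated_oscillation:
  assumes "x \<in> ball a d" "x' \<in> ball a d"
  shows "truncated_potential \<theta> d N x
    \<le> truncated_potential \<theta> d N x' + ennreal (\<theta> * 4 powr (\<theta> + 1) * 2 * M)"
proof -
  have d: "0 < d" using assms(1) by (auto intro: le_less_trans[OF zero_le_dist])
  have "dist x x' \<le> 2 * d" using assms dist_triangle3[of x x' a] by simp
  then have "\<theta> * 4 powr (\<theta> + 1) * M / d * dist x x' \<le> \<theta> * 4 powr (\<theta> + 1) * M / d * (2 * d)"
    using d \<theta>_pos M_pos by (intro mult_left_mono) auto
  then have "ennreal (\<theta> * 4 powr (\<theta> + 1) * (d / d) powr (\<theta> + 1) * M / d * dist x x')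
      \<le> ennreal (\<theta> * 4 powr (\<theta> + 1) * 2 * M)"
    using d by (intro ennreal_leI) (simp add: field_simps)
  then show ?thesis using assms d
    by (intro order_trans[OF truncated_lipschitz[of d d x a x']] add_left_mono) auto
qed

text \<open>
  The constant subtracted is the truncated potential at the centre, with truncation at the radius
  \<open>d\<close> itself, so that its oscillation over the ball is of order \<open>M\<close> whatever \<open>d\<close> is.
\<close>

lemma choquet_oscillation_le:
  assumes \<beta>: "\<theta> < \<beta>" and Q: "Q \<subseteq> ball a d" and x0: "x0 \<in> ball a d" "potential \<theta> N x0 < top"
  shows "\<exists>c::real. choquet_integral \<beta> Q (\<lambda>x. e2ennreal \<bar>enn2ereal (potential \<theta> N x) - ereal c\<bar>)
    \<le> ennreal (unit_ball_vol \<beta> * (\<theta> * 4 powr (\<theta> + 1) * 2 + 1 + 5 powr \<beta> * 2 powr \<theta> * (local_const \<beta>)\<^sup>2)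
         * M * d powr \<beta>)"
proof -
  have d: "0 < d" using x0(1) by (auto intro: le_less_trans[OF zero_le_dist])
  have "truncated_potential \<theta> d N a < top"
    using d x0 by (intro truncated_finite[where a=a and x'=x0]) auto
  then obtain c where c: "truncated_potential \<theta> d N a = ennreal c" "0 \<le> c"
    by (cases "truncated_potential \<theta> d N a") auto
  define K where "K = \<theta> * 4 powr (\<theta> + 1) * 2 * M"
  have "choquet_integral \<beta> Q (\<lambda>x. e2ennreal \<bar>enn2ereal (potential \<theta> N x) - ereal c\<bar>)
    \<le> ennreal (unit_ball_vol \<beta> * d powr \<beta> * (K + M + 5 powr \<beta> * 2 powr \<theta> * (local_const \<beta>)\<^sup>2 * M))"
  proof (rule choquet_integral_local_potential_le[OF \<beta> d Q])
    show K: "0 \<le> K" using \<theta>_pos M_pos by (simp add: K_def)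
    fix x assume "x \<in> Q"
    then have x: "x \<in> ball a d" using Q by auto
    show "e2ennreal \<bar>enn2ereal (potential \<theta> N x) - ereal c\<bar> \<le> local_potential d x + ennreal K"
    proof (rule extended_abs_diff_le[OF c(2) K])
      show "potential \<theta> N x \<le> truncated_potential \<theta> d N x + local_potential d x"
        unfolding local_potential_def by (rule potential_le_truncated[OF sets_N])
      show "truncated_potential \<theta> d N x \<le> potential \<theta> N x"
        by (rule truncated_potential_le[OF sets_N \<theta>_pos emeasure_singleton])
      show "truncated_potential \<theta> d N x \<le> ennreal c + ennreal K"
        using truncated_oscillation[of x a d a] x d c by (simp add: K_def)
      show "ennreal c \<le> truncated_potential \<theta> d N x + ennreal K"
        using truncated_oscillation[of a a d x] x d c by (simp add: K_def)
    qed
  qed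
  also have "unit_ball_vol \<beta> * d powr \<beta> * (K + M + 5 powr \<beta> * 2 powr \<theta> * (local_const \<beta>)\<^sup>2 * M)
    = unit_ball_vol \<beta> * (\<theta> * 4 powr (\<theta> + 1) * 2 + 1 + 5 powr \<beta> * 2 powr \<theta> * (local_const \<beta>)\<^sup>2)
         * M * d powr \<beta>"
    by (simp add: K_def algebra_simps)
  finally show ?thesis by blast
qed

lemma choquet_potential_finite:
  assumes \<beta>: "\<theta> < \<beta>" and Q: "Q \<subseteq> ball a d" and x0: "x0 \<in> ball a d" "potential \<theta> N x0 < top"
  shows "choquet_integral \<beta> Q (potential \<theta> N) < top"
proof -
  have d: "0 < d" using x0(1) by (auto intro: le_less_trans[OF zero_le_dist])
  have "truncated_potential \<theta> d N a < top"
    using d x0 by (intro truncated_finite[where a=a and x'=x0]) auto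
  then obtain c where c: "truncated_potential \<theta> d N a = ennreal c" "0 \<le> c"
    by (cases "truncated_potential \<theta> d N a") auto
  define K where "K = \<theta> * 4 powr (\<theta> + 1) * 2 * M"
  have K: "0 \<le> K" using \<theta>_pos M_pos by (simp add: K_def)
  have "choquet_integral \<beta> Q (potential \<theta> N)
    \<le> ennreal (unit_ball_vol \<beta> * d powr \<beta> * ((c + K) + M + 5 powr \<beta> * 2 powr \<theta> * (local_const \<beta>)\<^sup>2 * M))"
  proof (rule choquet_integral_local_potential_le[OF \<beta> d Q])
    show "0 \<le> c + K" using c K by simp
    fix x assume "x \<in> Q"
    then have x: "x \<in> ball a d" using Q by auto
    have "potential \<theta> N x \<le> truncated_potential \<theta> d N x + local_potential d x"
      unfolding local_potential_def by (rule potential_le_truncated[OF sets_N])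
    also have "truncated_potential \<theta> d N x \<le> ennreal c + ennreal K"
      using truncated_oscillation[of x a d a] x d c by (simp add: K_def)
    also have "ennreal c + ennreal K = ennreal (c + K)" using c K by simp
    finally show "potential \<theta> N x \<le> local_potential d x + ennreal (c + K)"
      by (simp add: add.commute add_right_mono)
  qed
  then show ?thesis by (auto intro: le_less_trans)
qed

text \<open>
  Points of \<open>Q\<close> that are not dense for the threshold \<open>s\<close> admit \<open>\<rho>\<close>-truncations that approximate the
  potential uniformly as \<open>\<rho>\<close> tends to \<open>0\<close>, and each truncation is Lipschitz. The dense points form an
  open set, of small content when \<open>s\<close> is large.
\<close>

lemma potential_quasicontinuous:
  assumes \<beta>: "\<theta> < \<beta>" and Q: "Q \<subseteq> ball a d" "open Q" and x0: "x0 \<in> ball a d" "potential \<theta> N x0 < top"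
  shows "quasicontinuous_on \<beta> Q (\<lambda>x. enn2ereal (potential \<theta> N x))"
  unfolding quasicontinuous_on_def
proof (intro allI impI)
  fix \<epsilon> :: real assume \<epsilon>: "0 < \<epsilon>"
  have d: "0 < d" using x0(1) by (auto intro: le_less_trans[OF zero_le_dist])
  have \<beta>0: "0 \<le> \<beta>" using \<beta> \<theta>_pos by simp
  define X where "X = unit_ball_vol \<beta> * 5 powr \<beta> * 2 powr \<theta> * M * d powr \<theta>"
  have X: "0 < X" using unit_ball_vol_pos[OF \<beta>0] M_pos d by (simp add: X_def)
  define s where "s = 2 * X / \<epsilon>"
  have s: "0 < s" using X \<epsilon> by (simp add: s_def)
  define U where "U = Q \<inter> dense_points \<beta> s d"
  define D where "D = local_const \<beta> * sqrt (M * s)"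
  have D: "0 < D" using local_const_pos[OF \<beta>] M_pos s by (simp add: D_def)
  let ?T = "\<lambda>\<rho>. truncated_potential \<theta> \<rho> N"
  have W: "local_potential \<rho> x \<le> ennreal (D * \<rho> powr ((\<beta> - \<theta>) / 2))" 
    if "x \<in> Q - U" "0 < \<rho>" "\<rho> \<le> d" for x \<rho>
    unfolding D_def using that \<beta> s by (intro local_potential_le[where d=d]) (auto simp: U_def)
  have upper: "potential \<theta> N x \<le> ?T \<rho> x + ennreal (D * \<rho> powr ((\<beta> - \<theta>) / 2))"
    if "x \<in> Q - U" "0 < \<rho>" "\<rho> \<le> d" for x \<rho>
    using W[OF that] unfolding local_potential_def
    by (intro order_trans[OF potential_le_truncated[OF sets_N, of \<theta> x \<rho>]] add_left_mono)
  have lower: "?T \<rho> x \<le> potential \<theta> N x" for x \<rho>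
    by (rule truncated_potential_le[OF sets_N \<theta>_pos emeasure_singleton])
  have fin: "potential \<theta> N x < top" if "x \<in> Q - U" for x
  proof -
    have "?T d x < top" using that Q d x0 by (intro truncated_finite[where a=a and x'=x0]) auto
    then show ?thesis using upper[OF that d] by (auto intro: le_less_trans)
  qed
  define v where "v x = enn2real (potential \<theta> N x)" for x
  have v: "potential \<theta> N x = ennreal (v x)" if "x \<in> Q - U" for x
    using fin[OF that] by (simp add: v_def)
  have v0: "0 \<le> v x" for x by (simp add: v_def)
  have "continuous_on (Q - U) v"
    unfolding continuous_on_iff
  proof (intro ballI allI impI)
    fix x \<eta> assume x: "x \<in> Q - U" and \<eta>: "(0::real) < \<eta>"
    define \<gamma> where "\<gamma> = (\<beta> - \<theta>) / 2"
    have \<gamma>: "0 < \<gamma>" using \<beta> by (simp add: \<gamma>_def)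
    define \<rho> where "\<rho> = min d ((\<eta> / (2 * D)) powr (1 / \<gamma>))"
    have \<rho>: "0 < \<rho>" "\<rho> \<le> d" using d \<eta> D by (auto simp: \<rho>_def)
    have "\<rho> powr \<gamma> \<le> ((\<eta> / (2 * D)) powr (1 / \<gamma>)) powr \<gamma>"
      using \<rho> \<gamma> by (intro powr_mono2) (auto simp: \<rho>_def)
    also have "\<dots> = \<eta> / (2 * D)" using \<gamma> \<eta> D by (simp add: powr_powr)
    finally have D\<rho>: "D * \<rho> powr \<gamma> \<le> \<eta> / 2" using D by (simp add: field_simps)
    define L where "L = \<theta> * 4 powr (\<theta> + 1) * (d / \<rho>) powr (\<theta> + 1) * M / d"
    have L: "0 < L" using \<theta>_pos d \<rho> M_pos by (simp add: L_def)
    have main: "v y \<le> v z + L * dist y z + \<eta> / 2" if "y \<in> Q - U" "z \<in> Q - U" for y z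
    proof -
      have "ennreal (v y) \<le> ?T \<rho> y + ennreal (D * \<rho> powr \<gamma>)"
        using upper[OF that(1) \<rho>] v[OF that(1)] by (simp add: \<gamma>_def)
      also have "?T \<rho> y \<le> ?T \<rho> z + ennreal (L * dist y z)"
        unfolding L_def using that Q \<rho> by (intro truncated_lipschitz[where a=a]) auto
      also have "?T \<rho> z \<le> ennreal (v z)" using lower v[OF that(2)] by metis
      also have "ennreal (D * \<rho> powr \<gamma>) \<le> ennreal (\<eta> / 2)" using D\<rho> by (rule ennreal_leI)
      also have "ennreal (v z) + ennreal (L * dist y z) + ennreal (\<eta> / 2) = ennreal (v z + L * dist y z + \<eta> / 2)"
        using v0 L \<eta> by (simp add: ennreal_plus)
      finally have "ennreal (v y) \<le> ennreal (v z + L * dist y z + \<eta> / 2)"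
        by (simp add: add_mono)
      moreover have "0 \<le> v z + L * dist y z + \<eta> / 2" using v0[of z] L \<eta> by simp
      ultimately show ?thesis by (simp add: ennreal_le_iff)
    qed
    show "\<exists>\<delta>>0. \<forall>x'\<in>Q - U. dist x' x < \<delta> \<longrightarrow> dist (v x') (v x) < \<eta>"
    proof (intro exI[of _ "\<eta> / (2 * L)"] conjI ballI impI)
      show "0 < \<eta> / (2 * L)" using \<eta> L by simp
      fix x' assume x': "x' \<in> Q - U" "dist x' x < \<eta> / (2 * L)"
      have "L * dist x' x < \<eta> / 2" using x'(2) L by (simp add: field_simps)
      then show "dist (v x') (v x) < \<eta>"
        using main[OF x x'(1)] main[OF x'(1) x] by (auto simp: dist_real_def dist_commute abs_if)
    qed
  qed
  then have "continuous_on (Q - U) (\<lambda>x. ereal (v x))" by (rule continuous_on_ereal)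
  moreover have ev: "enn2ereal (potential \<theta> N x) = ereal (v x)" if "x \<in> Q - U" for x
    using v[OF that] v0 by (simp add: enn2ereal_ennreal)
  ultimately have cont: "continuous_on (Q - U) (\<lambda>x. enn2ereal (potential \<theta> N x))"
    by (subst continuous_on_cong[OF refl ev])
  have "hausdorff_content \<beta> U \<le> ennreal (X / s)"
    unfolding U_def X_def using \<beta>0 d s Q by (intro content_dense_points_le)
  also have "ennreal (X / s) < ennreal \<epsilon>" using X \<epsilon> by (intro ennreal_lessI) (auto simp: s_def)
  finally have "hausdorff_content \<beta> U < ennreal \<epsilon>" .
  moreover have "open U" unfolding U_def dense_points_def
    using Q(2) open_large_density[OF sets_N] by (intro open_Int) auto
  ultimately show "\<exists>U. open U \<and> U \<subseteq> Q \<and> hausdorff_content \<beta> U < ennreal \<epsilon> \<and>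
      (\<forall>x\<in>Q - U. \<bar>enn2ereal (potential \<theta> N x)\<bar> \<noteq> \<infinity>) \<and>
      continuous_on (Q - U) (\<lambda>x. enn2ereal (potential \<theta> N x))"
    using cont ev by (intro exI[of _ U]) (auto simp: U_def)
qed

lemma potential_BMO_content:
  assumes \<beta>: "\<theta> < \<beta>" and fin: "\<And>a l. 0 < l \<Longrightarrow> \<exists>x\<in>open_cube a l. potential \<theta> N x < top"
  shows "(\<lambda>x. enn2ereal (potential \<theta> N x)) \<in> BMO_content \<beta>"
    and "BMO_content_norm \<beta> (\<lambda>x. enn2ereal (potential \<theta> N x))
      \<le> ennreal (real DIM('a) powr \<beta> * unit_ball_vol \<beta> *
          (\<theta> * 4 powr (\<theta> + 1) * 2 + 1 + 5 powr \<beta> * 2 powr \<theta> * (local_const \<beta>)\<^sup>2) * M)"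
proof -
  let ?n = "real DIM('a)"
  let ?u = "\<lambda>x. enn2ereal (potential \<theta> N x)"
  define C where "C = unit_ball_vol \<beta> * (\<theta> * 4 powr (\<theta> + 1) * 2 + 1 + 5 powr \<beta> * 2 powr \<theta> * (local_const \<beta>)\<^sup>2) * M"
  show norm: "BMO_content_norm \<beta> ?u \<le> ennreal (?n powr \<beta> * unit_ball_vol \<beta> *
          (\<theta> * 4 powr (\<theta> + 1) * 2 + 1 + 5 powr \<beta> * 2 powr \<theta> * (local_const \<beta>)\<^sup>2) * M)"
    unfolding BMO_content_norm_def
  proof (intro SUP_least)
    fix a :: 'a and l :: real assume "l \<in> {0<..}"
    then have l: "0 < l" by simp
    obtain x0 where x0: "x0 \<in> open_cube a l" "potential \<theta> N x0 < top" using fin[OF l] by blast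
    then have "x0 \<in> ball a (?n * l)" using open_cube_subset_ball[OF l, of a] by blast
    then obtain c where c: "choquet_integral \<beta> (open_cube a l) (\<lambda>x. e2ennreal \<bar>?u x - ereal c\<bar>)
        \<le> ennreal (C * (?n * l) powr \<beta>)"
      using choquet_oscillation_le[OF \<beta> open_cube_subset_ball[OF l] _ x0(2)]
      unfolding C_def by blast
    have "(INF c::real. choquet_integral \<beta> (open_cube a l) (\<lambda>x. e2ennreal \<bar>?u x - ereal c\<bar>) / ennreal (l powr \<beta>))
      \<le> choquet_integral \<beta> (open_cube a l) (\<lambda>x. e2ennreal \<bar>?u x - ereal c\<bar>) / ennreal (l powr \<beta>)"
      by (rule INF_lower) simp
    also have "\<dots> \<le> ennreal (C * (?n * l) powr \<beta>) / ennreal (l powr \<beta>)"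
      using c by (rule divide_right_mono_ennreal)
    also have "\<dots> = ennreal (C * (?n * l) powr \<beta> / l powr \<beta>)"
      using l \<beta> \<theta>_pos M_pos unit_ball_vol_pos[of \<beta>] by (intro divide_ennreal) (auto simp: C_def)
    also have "C * (?n * l) powr \<beta> / l powr \<beta> = ?n powr \<beta> * unit_ball_vol \<beta> *
          (\<theta> * 4 powr (\<theta> + 1) * 2 + 1 + 5 powr \<beta> * 2 powr \<theta> * (local_const \<beta>)\<^sup>2) * M"
      using l by (simp add: C_def powr_mult)
    finally show "(INF c::real. choquet_integral \<beta> (open_cube a l) (\<lambda>x. e2ennreal \<bar>?u x - ereal c\<bar>) / ennreal (l powr \<beta>))
      \<le> ennreal (?n powr \<beta> * unit_ball_vol \<beta> *
          (\<theta> * 4 powr (\<theta> + 1) * 2 + 1 + 5 powr \<beta> * 2 powr \<theta> * (local_const \<beta>)\<^sup>2) * M)" .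
  qed
  have "?u \<in> L1_loc_content \<beta>"
    unfolding L1_loc_content_def mem_Collect_eq
  proof (intro allI impI)
    fix a :: 'a and l :: real assume l: "0 < l"
    obtain x0 where x0: "x0 \<in> open_cube a l" "potential \<theta> N x0 < top" using fin[OF l] by blast
    note sub = open_cube_subset_ball[OF l, of a]
    have qc: "quasicontinuous_on \<beta> (open_cube a l) ?u"
      using x0 sub by (intro potential_quasicontinuous[OF \<beta> sub]) (auto simp: open_cube_def)
    have ch: "choquet_integral \<beta> (open_cube a l) (\<lambda>x. e2ennreal \<bar>?u x\<bar>) < \<infinity>"
      using choquet_potential_finite[OF \<beta> sub, of x0] x0 sub by (auto simp: e2ennreal_enn2ereal)
    show "?u \<in> L1_content \<beta> (open_cube a l)"
      unfolding L1_content_def mem_Collect_eq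
      by (intro conjI quasicontinuous_infinite_null qc ch)
  qed
  with norm show "?u \<in> BMO_content \<beta>" unfolding BMO_content_def
    by (auto intro: le_less_trans)
qed

end

section \<open>Bounded mean oscillation implies Morrey growth\<close>

text \<open>
  Here \<open>\<kappa> i\<close> stands for the kernel averaged over a cube of size \<open>2 ^ Suc i\<close>, at a point at distance
  \<open>p\<close> from the centre, and \<open>(b + p) powr -\<theta>\<close> for the lower bound of the average at size \<open>1\<close>. Let
  \<open>2 ^ m\<close> be the scale of \<open>p\<close>. The sizes below \<open>p\<close> have total weight \<open>1 - q ^ m\<close> and contribute
  \<open>p powr -\<theta>\<close> each up to a relative error \<open>2 ^ i / p\<close>; the sizes above \<open>p\<close> contribute geometrically
  decaying multiples of \<open>p powr -\<theta>\<close>. All errors carry the weight \<open>1 - q\<close> of a single size near \<open>p\<close>, so they are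
  \<open>(1 - q) * q ^ m\<close> up to a constant, and the deficit \<open>q ^ m\<close> wins when \<open>q\<close> is close to \<open>1\<close>.
\<close>

lemma geometric_mixture_kernel_bound:
  fixes \<theta> b C :: real
  assumes \<theta>: "0 < \<theta>" and b: "1 \<le> b" and C: "0 < C"
  shows "\<exists>q c. 0 < q \<and> q < 1 \<and> 0 < c \<and>
    (\<forall>p \<kappa>. 0 \<le> p \<longrightarrow> (\<forall>i::nat. 0 \<le> \<kappa> i) \<longrightarrow> (\<forall>i. \<kappa> i \<le> C * (2 ^ Suc i) powr -\<theta>) \<longrightarrow>
       (\<forall>i. b * 2 ^ Suc i < p \<longrightarrow> \<kappa> i \<le> (p - b * 2 ^ Suc i) powr -\<theta>) \<longrightarrow>
       summable (\<lambda>i. (1 - q) * q ^ i * \<kappa> i) \<and>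
       (\<Sum>i. (1 - q) * q ^ i * \<kappa> i) + (if p \<le> 1 then c else 0) \<le> (b + p) powr -\<theta>)"
proof -
  define A where "A = \<theta> * (1/2) powr (-\<theta>-1)"
  define z where "z = (2::real) powr -\<theta>"
  have z: "0 < z" "z < 1" using \<theta> by (auto simp: z_def powr_less_one)
  have A: "0 < A" using \<theta> by (simp add: A_def)
  define F where "F = C / (1 - z)"
  have F: "0 < F" using C z by (simp add: F_def)
  define E where "E = 2 * A + 2 powr \<theta> * b powr \<theta> * F"
  have E: "0 < E" using A F by (simp add: E_def add_pos_nonneg)
  obtain m0 where m0: "\<theta> < (3/2) ^ m0" using real_arch_pow[of "3/2" \<theta>] by auto
  \<comment> \<open>Beyond \<open>P\<close> the deficit \<open>q ^ m\<close> also absorbs the loss \<open>\<theta> * b / p\<close> in passing from \<open>p\<close> to \<open>b + p\<close>;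
      below \<open>P\<close> it is enough that the whole mixture is of order \<open>1 - q\<close>.\<close>
  define P where "P = b * 2 ^ Suc m0"
  have P: "1 < P"
  proof -
    have "1 * 2 \<le> b * (2 * 2 ^ m0)" using b by (intro mult_mono) auto
    then show ?thesis by (simp add: P_def)
  qed
  define G where "G = (b + P) powr -\<theta>"
  have G: "0 < G" using b P by (simp add: G_def)
  define \<delta> where "\<delta> = min (1/4) (min (1 / (2 * E)) (G / (2 * F)))"
  have \<delta>: "0 < \<delta>" "\<delta> \<le> 1/4" "\<delta> * E \<le> 1/2" "\<delta> * F \<le> G / 2"
  proof -
    show "0 < \<delta>" "\<delta> \<le> 1/4" using E F G by (auto simp: \<delta>_def)
    have "\<delta> \<le> 1 / (2 * E)" "\<delta> \<le> G / (2 * F)" by (auto simp: \<delta>_def)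
    then show "\<delta> * E \<le> 1/2" "\<delta> * F \<le> G / 2" using E F by (auto simp: field_simps)
  qed
  define q where "q = 1 - \<delta>"
  have q: "3/4 \<le> q" "q < 1" "0 < q" "1 - q = \<delta>" using \<delta> by (auto simp: q_def)
  have pow2: "(2 ^ k) powr -\<theta> = z ^ k" for k :: nat
  proof -
    have "((2::real) ^ k) powr -\<theta> = (2 powr real k) powr -\<theta>" by (simp add: powr_realpow)
    also have "\<dots> = (2 powr -\<theta>) powr real k" by (simp add: powr_powr mult.commute)
    also have "\<dots> = z ^ k" by (simp add: z_def powr_realpow)
    finally show ?thesis .
  qed
  have main: "summable (\<lambda>i. (1 - q) * q ^ i * \<kappa> i) \<and>
       (\<Sum>i. (1 - q) * q ^ i * \<kappa> i) + (if p \<le> 1 then G / 2 else 0) \<le> (b + p) powr -\<theta>"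
    if p: "0 \<le> p" and \<kappa>0: "\<And>i::nat. 0 \<le> \<kappa> i" and \<kappa>1: "\<And>i. \<kappa> i \<le> C * (2 ^ Suc i) powr -\<theta>"
      and \<kappa>2: "\<And>i. b * 2 ^ Suc i < p \<Longrightarrow> \<kappa> i \<le> (p - b * 2 ^ Suc i) powr -\<theta>" for p \<kappa>
  proof -
    have \<kappa>C: "\<kappa> i \<le> C * z ^ i" for i
    proof -
      have "\<kappa> i \<le> C * z ^ Suc i" using \<kappa>1[of i] unfolding pow2 .
      also have "\<dots> \<le> C * z ^ i" using C z by (intro mult_left_mono power_decreasing) auto
      finally show ?thesis .
    qed
    have term_le: "q ^ i * \<kappa> i \<le> C * z ^ i" for i
    proof -
      have "q ^ i * \<kappa> i \<le> 1 * \<kappa> i" using q \<kappa>0 by (intro mult_right_mono power_le_one) auto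
      then show ?thesis using \<kappa>C[of i] by simp
    qed
    have geo: "summable (\<lambda>i. C * z ^ i)" "(\<Sum>i. C * z ^ i) = F"
      using z by (auto intro!: summable_mult summable_geometric simp: suminf_mult suminf_geometric F_def)
    have sum0: "summable (\<lambda>i. q ^ i * \<kappa> i)"
      using term_le \<kappa>0 q by (intro summable_comparison_test'[OF geo(1)]) (simp add: abs_mult)
    then have summ: "summable (\<lambda>i. (1 - q) * q ^ i * \<kappa> i)"
      using summable_mult[OF sum0, of "1 - q"] by (simp add: mult.assoc)
    have sum_eq: "(\<Sum>i. (1 - q) * q ^ i * \<kappa> i) = \<delta> * (\<Sum>i. q ^ i * \<kappa> i)"
      using suminf_mult[OF sum0, of "1 - q"] q(4) by (simp add: mult.assoc)
    show ?thesis
    proof (cases "p < P")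
      case True
      have "(\<Sum>i. q ^ i * \<kappa> i) \<le> F"
        using suminf_le[OF term_le sum0 geo(1)] geo(2) by simp
      then have "\<delta> * (\<Sum>i. q ^ i * \<kappa> i) \<le> \<delta> * F" using \<delta> by (intro mult_left_mono) auto
      also have "\<dots> \<le> G / 2" by (rule \<delta>)
      finally have "(\<Sum>i. (1 - q) * q ^ i * \<kappa> i) \<le> G / 2" unfolding sum_eq .
      moreover have "G \<le> (b + p) powr -\<theta>"
        unfolding G_def using True p b \<theta> by (intro powr_mono2') auto
      ultimately show ?thesis using summ G by auto
    next
      case False
      then have pP: "P \<le> p" by simp
      then have p1: "1 < p" using P by simp
      \<comment> \<open>The scale \<open>m\<close> of \<open>p\<close>; exactly the indices \<open>i < m\<close> are cubes too small to reach half-way to \<open>p\<close>.\<close>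
      have ex: "\<exists>m. p < b * 2 ^ (m + 2)"
      proof -
        obtain m where "p / b < 2 ^ m" using real_arch_pow[of 2 "p / b"] by auto
        then have "p < b * 2 ^ m" using b by (simp add: field_simps)
        also have "\<dots> \<le> b * 2 ^ (m + 2)" using b by (intro mult_left_mono power_increasing) auto
        finally show ?thesis ..
      qed
      define m where "m = (LEAST m. p < b * 2 ^ (m + 2))"
      have m1: "p < b * 2 ^ (m + 2)" unfolding m_def using ex by (rule LeastI_ex)
      have mm0: "m0 \<le> m"
      proof (rule ccontr)
        assume "\<not> m0 \<le> m"
        then have "b * 2 ^ (m + 2) \<le> b * 2 ^ (m0 + 1)" using b by (intro mult_left_mono power_increasing) auto
        then show False using m1 pP by (simp add: P_def)
      qed
      have m2: "b * 2 ^ (m + 1) \<le> p"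
      proof (cases m)
        case 0
        then have "m0 = 0" using mm0 by simp
        then show ?thesis using pP 0 by (simp add: P_def)
      next
        case (Suc k)
        then have "\<not> p < b * 2 ^ (k + 2)"
          using not_less_Least[of k "\<lambda>m. p < b * 2 ^ (m + 2)"] by (auto simp: m_def)
        then show ?thesis using Suc by simp
      qed
      define y where "y = p powr -\<theta>"
      have y: "0 < y" using p1 by (simp add: y_def)
      have small: "\<kappa> i \<le> y * (1 + A * (b * 2 ^ Suc i / p))" if "i < m" for i
      proof -
        define t where "t = b * 2 ^ Suc i / p"
        have "b * 2 ^ (Suc i + 1) \<le> b * 2 ^ (m + 1)" using that b by (intro mult_left_mono power_increasing) auto
        then have "2 * (b * 2 ^ Suc i) \<le> p" using m2 by simp
        then have t: "0 < t" "t \<le> 1/2" using b p1 by (auto simp: t_def field_simps)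
        have pt: "p - b * 2 ^ Suc i = p * (1 - t)" using p1 by (simp add: t_def algebra_simps)
        have "0 < p * t" using t p1 by simp
        moreover have "p * t = b * 2 ^ Suc i" using p1 by (simp add: t_def)
        moreover have "0 < p * (1 - t)" using t p1 by simp
        ultimately have "\<kappa> i \<le> (p * (1 - t)) powr -\<theta>" using \<kappa>2[of i] pt by simp
        also have "\<dots> = y * (1 - t) powr -\<theta>" by (simp add: y_def powr_mult)
        also have "(1 - t) powr -\<theta> \<le> 1 powr -\<theta> + \<theta> * (1/2) powr (-\<theta>-1) * \<bar>(1 - t) - 1\<bar>"
          using t \<theta> by (intro powr_neg_diff_le) auto
        also have "\<dots> = 1 + A * t" using t by (simp add: A_def)
        finally show ?thesis using y by (simp add: t_def mult_left_mono)
      qed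
      have "(\<Sum>i<m. q ^ i * \<kappa> i) \<le> (\<Sum>i<m. y * q ^ i + y * (A * (b * 2 / p)) * (2 * q) ^ i)"
      proof (rule sum_mono)
        fix i assume "i \<in> {..<m}"
        then have "q ^ i * \<kappa> i \<le> q ^ i * (y * (1 + A * (b * 2 ^ Suc i / p)))"
          using small q by (intro mult_left_mono) auto
        then show "q ^ i * \<kappa> i \<le> y * q ^ i + y * (A * (b * 2 / p)) * (2 * q) ^ i"
          by (simp add: algebra_simps power_mult_distrib)
      qed
      also have "\<dots> = y * (\<Sum>i<m. q ^ i) + y * (A * (b * 2 / p)) * (\<Sum>i<m. (2 * q) ^ i)"
        by (simp add: sum.distrib sum_distrib_left)
      also have "(\<Sum>i<m. q ^ i) = (1 - q ^ m) / \<delta>"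
      proof -
        have "(\<Sum>i<m. q ^ i) = (q ^ m - 1) / (q - 1)" using q by (intro geometric_sum) auto
        also have "\<dots> = (1 - q ^ m) / (1 - q)" by (metis minus_diff_eq minus_divide_divide)
        finally show ?thesis unfolding q(4) .
      qed
      also have "y * (A * (b * 2 / p)) * (\<Sum>i<m. (2 * q) ^ i) \<le> y * (A * (b * 2 / p)) * (2 * (2 ^ m * q ^ m))"
      proof (intro mult_left_mono)
        have "(\<Sum>i<m. (2 * q) ^ i) = ((2 * q) ^ m - 1) / (2 * q - 1)"
          using q by (subst geometric_sum) auto
        also have "\<dots> \<le> (2 * q) ^ m / (1/2)"
          using q by (intro frac_le) auto
        finally show "(\<Sum>i<m. (2 * q) ^ i) \<le> 2 * (2 ^ m * q ^ m)" by (simp add: power_mult_distrib)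
      qed (use y A b p1 in auto)
      also have "y * (A * (b * 2 / p)) * (2 * (2 ^ m * q ^ m)) \<le> y * (2 * A) * q ^ m"
      proof -
        have "b * 2 * 2 ^ m / p \<le> 1" using m2 p1 by simp
        then have "(y * (2 * A) * q ^ m) * (b * 2 * 2 ^ m / p) \<le> (y * (2 * A) * q ^ m) * 1"
          using y A q by (intro mult_left_mono) auto
        then show ?thesis by (simp add: mult_ac)
      qed
      finally have head: "(\<Sum>i<m. q ^ i * \<kappa> i) \<le> y * ((1 - q ^ m) / \<delta>) + y * (2 * A) * q ^ m"
        by simp
      have zm: "z ^ Suc m \<le> 2 powr \<theta> * b powr \<theta> * y"
      proof -
        have "z ^ Suc (Suc m) = (2 ^ (m + 2)) powr -\<theta>" unfolding pow2 by simp
        also have "\<dots> \<le> (p / b) powr -\<theta>"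
          using m1 p1 b \<theta> by (intro powr_mono2') (auto simp: field_simps)
        also have "\<dots> = y * b powr \<theta>" unfolding powr_divide y_def by (simp add: powr_minus_divide)
        finally have "z * z ^ Suc m \<le> y * b powr \<theta>" by simp
        then have "2 powr \<theta> * (z * z ^ Suc m) \<le> 2 powr \<theta> * (y * b powr \<theta>)" by (intro mult_left_mono) auto
        moreover have "2 powr \<theta> * z = 1" by (simp add: z_def powr_add[symmetric])
        then have "2 powr \<theta> * (z * z ^ Suc m) = z ^ Suc m" by (metis mult.assoc mult_1)
        ultimately show ?thesis by (simp only: mult_ac)
      qed
      have tail_le: "q ^ (i + m) * \<kappa> (i + m) \<le> q ^ m * (2 powr \<theta> * b powr \<theta> * y) * (C * z ^ i)" for i
      proof -
        have "\<kappa> (i + m) \<le> C * z ^ Suc (i + m)" using \<kappa>1[of "i + m"] unfolding pow2 .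
        also have "\<dots> = C * z ^ i * z ^ Suc m" by (simp add: power_add)
        also have "\<dots> \<le> C * z ^ i * (2 powr \<theta> * b powr \<theta> * y)" using C z by (intro mult_left_mono zm) auto
        finally have k: "\<kappa> (i + m) \<le> C * z ^ i * (2 powr \<theta> * b powr \<theta> * y)" .
        have "q ^ (i + m) \<le> q ^ m" using q by (intro power_decreasing) auto
        with k have "q ^ (i + m) * \<kappa> (i + m) \<le> q ^ m * (C * z ^ i * (2 powr \<theta> * b powr \<theta> * y))"
          using \<kappa>0 q by (intro mult_mono) auto
        then show ?thesis by (simp only: mult_ac)
      qed
      have "(\<Sum>i. q ^ (i + m) * \<kappa> (i + m)) \<le> (\<Sum>i. q ^ m * (2 powr \<theta> * b powr \<theta> * y) * (C * z ^ i))"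
        using sum0 by (intro suminf_le tail_le summable_mult geo(1)) (rule summable_ignore_initial_segment)
      also have "\<dots> = q ^ m * (2 powr \<theta> * b powr \<theta> * y) * F"
        using suminf_mult[OF geo(1)] geo(2) by metis
      finally have tail: "(\<Sum>i. q ^ (i + m) * \<kappa> (i + m)) \<le> y * (2 powr \<theta> * b powr \<theta> * F) * q ^ m"
        by (simp only: mult_ac)
      have "(\<Sum>i. q ^ i * \<kappa> i) = (\<Sum>i. q ^ (i + m) * \<kappa> (i + m)) + (\<Sum>i<m. q ^ i * \<kappa> i)"
        by (rule suminf_split_initial_segment[OF sum0])
      also have "\<dots> \<le> y * ((1 - q ^ m) / \<delta>) + y * E * q ^ m"
        using head tail by (simp add: E_def algebra_simps)
      finally have "\<delta> * (\<Sum>i. q ^ i * \<kappa> i) \<le> \<delta> * (y * ((1 - q ^ m) / \<delta>) + y * E * q ^ m)"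
        using \<delta> by (intro mult_left_mono) auto
      also have "\<dots> = y * (1 - q ^ m) + (\<delta> * E) * (y * q ^ m)"
        using \<delta> by (simp add: field_simps)
      also have "\<dots> \<le> y * (1 - q ^ m) + 1/2 * (y * q ^ m)"
        using \<delta> y q by (intro add_left_mono mult_right_mono) auto
      finally have up: "\<delta> * (\<Sum>i. q ^ i * \<kappa> i) \<le> y - 1/2 * (y * q ^ m)" by (simp add: algebra_simps)
      have "y \<le> (b + p) powr -\<theta> + \<theta> * p powr (-\<theta>-1) * \<bar>p - (b + p)\<bar>"
        unfolding y_def using p1 b \<theta> by (intro powr_neg_diff_le) auto
      also have "\<theta> * p powr (-\<theta>-1) * \<bar>p - (b + p)\<bar> = y * (\<theta> * (b / p))"
        using p1 b by (simp add: y_def powr_diff)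
      also have "\<dots> \<le> y * (1/2 * q ^ m)"
      proof (intro mult_left_mono)
        have "\<theta> \<le> (3/2) ^ m0" using m0 by simp
        also have "\<dots> \<le> (3/2) ^ m" using mm0 by (intro power_increasing) auto
        also have "\<dots> \<le> (2 * q) ^ m" using q by (intro power_mono) auto
        finally have "\<theta> \<le> 2 ^ m * q ^ m" by (simp add: power_mult_distrib)
        moreover have "b / p \<le> 1 / (2 * 2 ^ m)" using m2 p1 b by (simp add: field_simps)
        ultimately have "\<theta> * (b / p) \<le> (2 ^ m * q ^ m) * (1 / (2 * 2 ^ m))"
          using b p1 q by (intro mult_mono) auto
        then show "\<theta> * (b / p) \<le> 1/2 * q ^ m" by simp
      qed (use y in auto)
      finally have "y - 1/2 * (y * q ^ m) \<le> (b + p) powr -\<theta>" by simp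
      with up p1 summ show ?thesis unfolding sum_eq by simp
    qed
  qed
  have "\<forall>p \<kappa>. 0 \<le> p \<longrightarrow> (\<forall>i::nat. 0 \<le> \<kappa> i) \<longrightarrow> (\<forall>i. \<kappa> i \<le> C * (2 ^ Suc i) powr -\<theta>) \<longrightarrow>
       (\<forall>i. b * 2 ^ Suc i < p \<longrightarrow> \<kappa> i \<le> (p - b * 2 ^ Suc i) powr -\<theta>) \<longrightarrow>
       summable (\<lambda>i. (1 - q) * q ^ i * \<kappa> i) \<and>
       (\<Sum>i. (1 - q) * q ^ i * \<kappa> i) + (if p \<le> 1 then G / 2 else 0) \<le> (b + p) powr -\<theta>"
    by (intro allI impI, rule main) (assumption | erule spec | erule allE, erule mp, assumption)+
  moreover have "0 < q" "q < 1" "0 < G / 2" using q G by auto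
  ultimately show ?thesis by (intro exI[of _ q] exI[of _ "G / 2"] conjI)
qed

text \<open>
  The cube is centred at \<open>x\<close> and \<open>R\<close> is half of its side.
\<close>

definition cube_avg :: "'a::euclidean_space \<Rightarrow> real \<Rightarrow> ('a \<Rightarrow> ennreal) \<Rightarrow> ennreal" where
  "cube_avg x R g = ennreal (1 / (2 * R) ^ DIM('a)) *
     (\<integral>\<^sup>+ y \<in> open_cube (x - R *\<^sub>R One) (2 * R). g y \<partial>lborel)"

lemma mem_centred_cube:
  "y \<in> open_cube (x - R *\<^sub>R One) (2 * R) \<longleftrightarrow> (\<forall>b\<in>Basis. \<bar>(y - x) \<bullet> b\<bar> < R)"
  by (auto simp: open_cube_def mem_box inner_simps abs_less_iff)

lemma dist_centred_cube:
  fixes x :: "'a::euclidean_space"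
  assumes "y \<in> open_cube (x - R *\<^sub>R One) (2 * R)"
  shows "dist x y \<le> real DIM('a) * R"
proof -
  have "dist x y = norm (y - x)" by (simp add: dist_norm norm_minus_commute)
  also have "\<dots> \<le> (\<Sum>b\<in>Basis. \<bar>(y - x) \<bullet> b\<bar>)" by (rule norm_le_l1)
  also have "\<dots> \<le> (\<Sum>b\<in>(Basis::'a set). R)"
    using assms by (intro sum_mono) (auto simp: mem_centred_cube intro: less_imp_le)
  finally show ?thesis by simp
qed

lemma cube_avg_const:
  assumes "0 < R"
  shows "cube_avg x R (\<lambda>_. k) = k"
proof -
  have "cube_avg x R (\<lambda>_. k) = ennreal (1 / (2 * R) ^ DIM('a)) * (k * ennreal ((2 * R) ^ DIM('a)))"
    unfolding cube_avg_def using assms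
    by (subst nn_integral_cmult_indicator) (simp_all add: emeasure_open_cube)
  also have "\<dots> = k * (ennreal (1 / (2 * R) ^ DIM('a)) * ennreal ((2 * R) ^ DIM('a)))"
    by (simp add: mult_ac)
  also have "ennreal (1 / (2 * R) ^ DIM('a)) * ennreal ((2 * R) ^ DIM('a)) = 1"
    using assms by (simp add: ennreal_mult[symmetric])
  finally show ?thesis by simp
qed

lemma cube_avg_mono_AE:
  assumes "AE y in lborel. y \<in> open_cube (x - R *\<^sub>R One) (2 * R) \<longrightarrow> g y \<le> h y"
  shows "cube_avg x R g \<le> cube_avg x R h"
  unfolding cube_avg_def using assms
  by (intro mult_left_mono nn_integral_mono_AE) (auto simp: indicator_def elim!: eventually_mono)

lemma cube_avg_mono:
  assumes "\<And>y. y \<in> open_cube (x - R *\<^sub>R One) (2 * R) \<Longrightarrow> g y \<le> h y"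
  shows "cube_avg x R g \<le> cube_avg x R h"
  using assms by (intro cube_avg_mono_AE) auto

lemma cube_avg_add:
  assumes [measurable]: "g \<in> borel_measurable borel" "h \<in> borel_measurable borel"
  shows "cube_avg x R (\<lambda>y. g y + h y) = cube_avg x R g + cube_avg x R h"
  unfolding cube_avg_def distrib_right
  by (subst nn_integral_add) (simp_all add: distrib_left)

lemma cube_avg_double:
  fixes x :: "'a::euclidean_space"
  assumes "0 < R"
  shows "cube_avg x R g \<le> ennreal (2 ^ DIM('a)) * cube_avg x (2 * R) g"
proof -
  have "cube_avg x R g \<le> ennreal (1 / (2 * R) ^ DIM('a)) *
     (\<integral>\<^sup>+ y \<in> open_cube (x - (2 * R) *\<^sub>R One) (2 * (2 * R)). g y \<partial>lborel)"
  proof -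
    have "open_cube (x - R *\<^sub>R One) (2 * R) \<subseteq> open_cube (x - (2 * R) *\<^sub>R One) (2 * (2 * R))"
      using assms unfolding subset_iff mem_centred_cube by force
    then show ?thesis unfolding cube_avg_def
      by (intro mult_left_mono nn_integral_mono) (auto simp: indicator_def)
  qed
  also have "ennreal (1 / (2 * R) ^ DIM('a)) = ennreal (2 ^ DIM('a)) * ennreal (1 / (2 * (2 * R)) ^ DIM('a))"
  proof -
    have "(2 * (2 * R)) ^ DIM('a) = 2 ^ DIM('a) * (2 * R) ^ DIM('a)" by (rule power_mult_distrib)
    then show ?thesis using assms by (simp add: ennreal_mult[symmetric])
  qed
  finally show ?thesis unfolding cube_avg_def by (simp add: mult.assoc)
qed

text \<open>
  Tonelli's theorem is applied to Lebesgue measure, with \<open>h\<close> as a factor of the integrand: \<open>h\<close> may be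
  infinite on a set of positive measure, and then \<open>density lborel h\<close> is not sigma-finite.
\<close>

lemma cube_avg_potential:
  fixes h :: "'a::euclidean_space \<Rightarrow> ennreal"
  assumes [measurable]: "h \<in> borel_measurable borel"
  shows "cube_avg x R (\<lambda>z. \<integral>\<^sup>+ y. h y * ennreal (dist z y powr -\<theta>) \<partial>lborel)
    = (\<integral>\<^sup>+ y. h y * cube_avg x R (\<lambda>z. ennreal (dist z y powr -\<theta>)) \<partial>lborel)"
proof -
  let ?Q = "open_cube (x - R *\<^sub>R One) (2 * R)"
  have "(\<integral>\<^sup>+ z \<in> ?Q. (\<integral>\<^sup>+ y. h y * ennreal (dist z y powr -\<theta>) \<partial>lborel) \<partial>lborel)
    = (\<integral>\<^sup>+ z. (\<integral>\<^sup>+ y. h y * ennreal (dist z y powr -\<theta>) * indicator ?Q z \<partial>lborel) \<partial>lborel)"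
    by (intro nn_integral_cong nn_integral_multc[symmetric]) measurable
  also have "\<dots> = (\<integral>\<^sup>+ y. (\<integral>\<^sup>+ z. h y * ennreal (dist z y powr -\<theta>) * indicator ?Q z \<partial>lborel) \<partial>lborel)"
    by (rule lborel_pair.Fubini') measurable
  also have "\<dots> = (\<integral>\<^sup>+ y. h y * (\<integral>\<^sup>+ z \<in> ?Q. ennreal (dist z y powr -\<theta>) \<partial>lborel) \<partial>lborel)"
    unfolding mult.assoc by (intro nn_integral_cong nn_integral_cmult) measurable
  finally show ?thesis
    unfolding cube_avg_def
    by (simp add: nn_integral_cmult[symmetric] mult.left_commute)
qed

text \<open>
  Every point of the cube is within \<open>n * R + dist x y\<close> of \<open>y\<close>. The point \<open>y\<close> itself, where the kernel takes
  the value \<open>0\<close> by the convention \<open>0 powr -\<theta> = 0\<close>, is negligible.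
\<close>

lemma cube_avg_kernel_ge:
  fixes x :: "'a::euclidean_space"
  assumes "0 < \<theta>" "0 < R"
  shows "ennreal ((real DIM('a) * R + dist x y) powr -\<theta>) \<le> cube_avg x R (\<lambda>z. ennreal (dist z y powr -\<theta>))"
proof -
  have "cube_avg x R (\<lambda>_. ennreal ((real DIM('a) * R + dist x y) powr -\<theta>))
    \<le> cube_avg x R (\<lambda>z. ennreal (dist z y powr -\<theta>))"
  proof (rule cube_avg_mono_AE)
    have "AE z in lborel. z \<noteq> y" by (rule AE_lborel_singleton)
    then show "AE z in lborel. z \<in> open_cube (x - R *\<^sub>R One) (2 * R) \<longrightarrow>
       ennreal ((real DIM('a) * R + dist x y) powr -\<theta>) \<le> ennreal (dist z y powr -\<theta>)"
    proof (eventually_elim, intro impI)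
      fix z assume z: "z \<noteq> y" "z \<in> open_cube (x - R *\<^sub>R One) (2 * R)"
      have "dist z y \<le> real DIM('a) * R + dist x y"
        using dist_centred_cube[OF z(2)] dist_triangle[of z y x] by (simp add: dist_commute)
      then show "ennreal ((real DIM('a) * R + dist x y) powr -\<theta>) \<le> ennreal (dist z y powr -\<theta>)"
        using z(1) assms by (intro ennreal_leI powr_mono2') auto
    qed
  qed
  then show ?thesis using assms by (simp add: cube_avg_const)
qed

lemma cube_avg_kernel_le_far:
  fixes x :: "'a::euclidean_space"
  assumes "0 < \<theta>" "0 < R" "real DIM('a) * R < dist x y"
  shows "cube_avg x R (\<lambda>z. ennreal (dist z y powr -\<theta>)) \<le> ennreal ((dist x y - real DIM('a) * R) powr -\<theta>)"
proof -
  have "cube_avg x R (\<lambda>z. ennreal (dist z y powr -\<theta>))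
    \<le> cube_avg x R (\<lambda>_. ennreal ((dist x y - real DIM('a) * R) powr -\<theta>))"
  proof (rule cube_avg_mono)
    fix z assume z: "z \<in> open_cube (x - R *\<^sub>R One) (2 * R)"
    have "dist x y - real DIM('a) * R \<le> dist z y"
      using dist_centred_cube[OF z] dist_triangle[of x y z] by simp
    then show "ennreal (dist z y powr -\<theta>) \<le> ennreal ((dist x y - real DIM('a) * R) powr -\<theta>)"
      using assms by (intro ennreal_leI powr_mono2') auto
  qed
  then show ?thesis using assms by (simp add: cube_avg_const)
qed

text \<open>
  The kernel exceeds \<open>R powr -\<theta>\<close> only on \<open>ball y R\<close>, where the growth of order \<open>n > \<theta>\<close> of Lebesgue measure
  bounds its integral.
\<close>

lemma cube_avg_kernel_le:
  fixes x :: "'a::euclidean_space"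
  assumes \<theta>: "0 < \<theta>" "\<theta> < real DIM('a)" and R: "0 < R"
  shows "cube_avg x R (\<lambda>z. ennreal (dist z y powr -\<theta>))
    \<le> ennreal ((1 + 2 powr \<theta> / (1 - 2 powr (\<theta> - real DIM('a))) * unit_ball_vol (real DIM('a))) * R powr -\<theta>)"
proof -
  let ?n = "real DIM('a)"
  define B where "B = 2 powr \<theta> / (1 - 2 powr (\<theta> - ?n)) * unit_ball_vol ?n"
  have B: "0 \<le> B" using \<theta> unit_ball_vol_pos[of ?n] unfolding B_def
    by (intro mult_nonneg_nonneg divide_nonneg_nonneg) (auto simp: powr_le_one_le less_imp_le powr_less_one)
  have "cube_avg x R (\<lambda>z. ennreal (dist z y powr -\<theta>))
    \<le> cube_avg x R (\<lambda>z. ennreal (R powr -\<theta>) + ennreal (dist y z powr -\<theta>) * indicator (ball y R) z)"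
    using R \<theta> by (intro cube_avg_mono) (auto simp: indicator_def dist_commute intro!: ennreal_leI powr_mono2')
  also have "\<dots> = ennreal (R powr -\<theta>) + cube_avg x R (\<lambda>z. ennreal (dist y z powr -\<theta>) * indicator (ball y R) z)"
    using R by (subst cube_avg_add) (measurable, simp add: cube_avg_const)
  also have "cube_avg x R (\<lambda>z. ennreal (dist y z powr -\<theta>) * indicator (ball y R) z)
    \<le> ennreal (1 / (2 * R) ^ DIM('a)) * (\<integral>\<^sup>+ z \<in> ball y R. ennreal (dist y z powr -\<theta>) \<partial>lborel)"
    unfolding cube_avg_def by (intro mult_left_mono nn_integral_mono) (auto simp: indicator_def)
  also have "(\<integral>\<^sup>+ z \<in> ball y R. ennreal (dist y z powr -\<theta>) \<partial>lborel) \<le> ennreal (B * R powr (?n - \<theta>))"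
    unfolding B_def
  proof (rule nn_integral_kernel_ball_le)
    fix r :: real assume "0 < r" 
    then show "emeasure lborel (ball y r) \<le> ennreal (unit_ball_vol ?n * r powr ?n)"
      by (subst emeasure_ball) (auto simp: powr_realpow)
  qed (use \<theta> R unit_ball_vol_pos[of ?n] in auto)
  also have "ennreal (1 / (2 * R) ^ DIM('a)) * ennreal (B * R powr (?n - \<theta>)) \<le> ennreal (B * R powr -\<theta>)"
  proof -
    have "1 / (2 * R) ^ DIM('a) * (B * R powr (?n - \<theta>)) = (1 / 2 ^ DIM('a)) * (B * R powr -\<theta>)"
      using R by (simp add: power_mult_distrib powr_diff powr_realpow powr_minus_divide)
    also have "\<dots> \<le> 1 * (B * R powr -\<theta>)" using B by (intro mult_right_mono) (auto simp: divide_le_eq)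
    finally show ?thesis using R B by (subst ennreal_mult[symmetric]) auto
  qed
  also have "ennreal (R powr -\<theta>) + ennreal (B * R powr -\<theta>) = ennreal ((1 + B) * R powr -\<theta>)"
    using B by (subst ennreal_plus[symmetric]) (auto simp: algebra_simps)
  finally show ?thesis unfolding B_def by (simp add: add_left_mono mult_left_mono)
qed

text \<open>
  Both averages are compared with the constant \<open>c\<close>. The small cube has the fraction \<open>2 powr -n\<close> of the
  volume of the large one, so averaging over it costs a factor \<open>2 ^ n\<close>.
\<close>

lemma cube_avg_oscillation:
  fixes x :: "'a::euclidean_space"
  assumes [measurable]: "u \<in> borel_measurable borel" and R: "0 < R"
    and X: "0 \<le> X" "cube_avg x (2 * R) (\<lambda>y. e2ennreal \<bar>enn2ereal (u y) - ereal c\<bar>) \<le> ennreal X"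
  shows "cube_avg x R u \<le> cube_avg x (2 * R) u + ennreal ((2 ^ DIM('a) + 1) * X)"
proof -
  define e where "e y = e2ennreal \<bar>enn2ereal (u y) - ereal c\<bar>" for y
  have [measurable]: "e \<in> borel_measurable borel" unfolding e_def by measurable
  have "cube_avg x R u \<le> cube_avg x R (\<lambda>y. ennreal c + e y)"
    unfolding e_def by (intro cube_avg_mono le_add_extended_abs_diff)
  also have "\<dots> = ennreal c + cube_avg x R e"
    using R by (subst cube_avg_add) (auto simp: cube_avg_const)
  also have "cube_avg x R e \<le> ennreal (2 ^ DIM('a)) * cube_avg x (2 * R) e" by (rule cube_avg_double[OF R])
  also have "cube_avg x (2 * R) e \<le> ennreal X" using X(2) unfolding e_def .
  also have "ennreal c = cube_avg x (2 * R) (\<lambda>_. ennreal c)" using R by (simp add: cube_avg_const)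
  also have "\<dots> \<le> cube_avg x (2 * R) (\<lambda>y. u y + e y)"
    unfolding e_def by (intro cube_avg_mono ennreal_le_add_extended_abs_diff)
  also have "\<dots> = cube_avg x (2 * R) u + cube_avg x (2 * R) e" by (intro cube_avg_add) measurable
  also have "cube_avg x (2 * R) e \<le> ennreal X" using X(2) unfolding e_def .
  finally have "cube_avg x R u \<le> cube_avg x (2 * R) u + ennreal X + ennreal (2 ^ DIM('a)) * ennreal X"
    by (simp add: add_mono mult_left_mono)
  also have "\<dots> = cube_avg x (2 * R) u + ennreal ((2 ^ DIM('a) + 1) * X)"
  proof -
    have "ennreal (2 ^ DIM('a)) * ennreal X = ennreal (2 ^ DIM('a) * X)"
      using X(1) by (simp add: ennreal_mult)
    moreover have "ennreal X + ennreal (2 ^ DIM('a) * X) = ennreal (X + 2 ^ DIM('a) * X)"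
      using X(1) by (intro ennreal_plus[symmetric]) auto
    ultimately show ?thesis by (simp add: add.assoc distrib_right add.commute)
  qed
  finally show ?thesis .
qed

text \<open>
  Let \<open>\<Phi> R\<close> be the average of the potential over the cube of half-side \<open>R\<close> about \<open>x\<close>. The kernel
  comparison, integrated against the density, says that the mixture of the \<open>\<Phi> (r * 2 ^ Suc i)\<close> plus a
  multiple of \<open>r powr -\<theta> * N (ball x r)\<close> is at most \<open>\<Phi> r\<close>. The oscillation estimate bounds \<open>\<Phi> r\<close> from
  above by the same mixture plus a constant times \<open>X\<close>. The mixture is finite and cancels.
\<close>

theorem BMO_potential_imp_morrey:
  fixes \<theta> :: real
  assumes \<theta>: "0 < \<theta>" "\<theta> < real DIM('a::euclidean_space)"
  obtains C where "0 < C"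
    "\<And>(h :: 'a \<Rightarrow> ennreal) X x r. h \<in> borel_measurable borel \<Longrightarrow> 0 < X \<Longrightarrow> 0 < r \<Longrightarrow>
      (\<And>a l. 0 < l \<Longrightarrow> (\<integral>\<^sup>+ y \<in> open_cube a l. potential \<theta> (density lborel h) y \<partial>lborel) < \<infinity>) \<Longrightarrow>
      (\<And>a l. 0 < l \<Longrightarrow> \<exists>c::real. (\<integral>\<^sup>+ y \<in> open_cube a l.
          e2ennreal \<bar>enn2ereal (potential \<theta> (density lborel h) y) - ereal c\<bar> \<partial>lborel) \<le> ennreal (l ^ DIM('a)) * ennreal X) \<Longrightarrow>
      emeasure (density lborel h) (ball x r) \<le> ennreal (C * X * r powr \<theta>)"
proof -
  let ?n = "real DIM('a)"
  define K where "K = 1 + 2 powr \<theta> / (1 - 2 powr (\<theta> - ?n)) * unit_ball_vol ?n"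
  have K: "0 < K" using \<theta> unit_ball_vol_pos[of ?n] unfolding K_def
    by (intro add_pos_nonneg mult_nonneg_nonneg divide_nonneg_nonneg) (auto simp: less_imp_le powr_less_one)
  have n1: "1 \<le> ?n" using DIM_positive[where 'a='a] by (simp add: Suc_le_eq)
  obtain q c where q: "0 < q" "q < 1" "0 < c" and mix:
    "\<forall>p \<kappa>. 0 \<le> p \<longrightarrow> (\<forall>i::nat. 0 \<le> \<kappa> i) \<longrightarrow> (\<forall>i. \<kappa> i \<le> K * (2 ^ Suc i) powr -\<theta>) \<longrightarrow>
       (\<forall>i. ?n * 2 ^ Suc i < p \<longrightarrow> \<kappa> i \<le> (p - ?n * 2 ^ Suc i) powr -\<theta>) \<longrightarrow>
       summable (\<lambda>i. (1 - q) * q ^ i * \<kappa> i) \<and>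
       (\<Sum>i. (1 - q) * q ^ i * \<kappa> i) + (if p \<le> 1 then c else 0) \<le> (?n + p) powr -\<theta>"
    using geometric_mixture_kernel_bound[OF \<theta>(1) n1 K] by (elim exE conjE)
  define S where "S = (\<Sum>i. (1 - q) * (real (Suc i) * q ^ i))"
  have S_summable: "summable (\<lambda>i. (1 - q) * (real (Suc i) * q ^ i))"
    using geometric_deriv_sums[of q] q by (intro summable_mult) (auto dest: sums_summable)
  have S: "0 < S" unfolding S_def using q by (intro suminf_pos[OF S_summable]) auto
  define C where "C = S * (2 ^ DIM('a) + 1) / c"
  show thesis
  proof (rule that[of C])
    show "0 < C" using S q by (simp add: C_def add_pos_pos)
    fix h :: "'a \<Rightarrow> ennreal" and X :: real and x :: 'a and r :: real
    assume h [measurable]: "h \<in> borel_measurable borel" and X: "0 < X" and r: "0 < r"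
      and fin: "\<And>a l. 0 < l \<Longrightarrow> (\<integral>\<^sup>+ y \<in> open_cube a l. potential \<theta> (density lborel h) y \<partial>lborel) < \<infinity>"
      and osc: "\<And>a l. 0 < l \<Longrightarrow> \<exists>c::real. (\<integral>\<^sup>+ y \<in> open_cube a l.
          e2ennreal \<bar>enn2ereal (potential \<theta> (density lborel h) y) - ereal c\<bar> \<partial>lborel) \<le> ennreal (l ^ DIM('a)) * ennreal X"
    define u where "u = potential \<theta> (density lborel h)"
    have u_eq: "u z = (\<integral>\<^sup>+ y. h y * ennreal (dist z y powr -\<theta>) \<partial>lborel)" for z
      unfolding u_def potential_def by (rule nn_integral_density) measurable
    have [measurable]: "u \<in> borel_measurable borel"
      unfolding u_eq[abs_def] by measurable
    define \<Phi> where "\<Phi> R = cube_avg x R u" for R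
    define k where "k R y = cube_avg x R (\<lambda>z. ennreal (dist z y powr -\<theta>))" for R y
    have \<Phi>_eq: "\<Phi> R = (\<integral>\<^sup>+ y. h y * k R y \<partial>lborel)" for R
      unfolding \<Phi>_def k_def u_eq[abs_def] by (rule cube_avg_potential) measurable
    have k_meas [measurable]: "k R \<in> borel_measurable borel" for R
      unfolding k_def[abs_def] cube_avg_def by measurable
    define D where "D = (2 ^ DIM('a) + 1) * X"
    have D: "0 < D" using X by (simp add: D_def add_pos_pos)
    have \<Phi>_step: "\<Phi> R \<le> \<Phi> (2 * R) + ennreal D" if R: "0 < R" for R
    proof -
      obtain c' where c': "(\<integral>\<^sup>+ y \<in> open_cube (x - (2 * R) *\<^sub>R One) (2 * (2 * R)).
          e2ennreal \<bar>enn2ereal (u y) - ereal c'\<bar> \<partial>lborel) \<le> ennreal ((2 * (2 * R)) ^ DIM('a)) * ennreal X"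
        using osc[of "2 * (2 * R)" "x - (2 * R) *\<^sub>R One"] R unfolding u_def by auto
      have "cube_avg x (2 * R) (\<lambda>y. e2ennreal \<bar>enn2ereal (u y) - ereal c'\<bar>)
        \<le> ennreal (1 / (2 * (2 * R)) ^ DIM('a)) * (ennreal ((2 * (2 * R)) ^ DIM('a)) * ennreal X)"
        unfolding cube_avg_def by (intro mult_left_mono c') auto
      also have "\<dots> = ennreal X"
        using R by (simp add: mult.assoc[symmetric] ennreal_mult[symmetric])
      finally show ?thesis unfolding \<Phi>_def D_def using R X
        by (intro cube_avg_oscillation) auto
    qed
    have \<Phi>_iter: "\<Phi> r \<le> \<Phi> (r * 2 ^ i) + ennreal (real i * D)" for i
    proof (induction i)
      case (Suc i)
      have "\<Phi> r \<le> \<Phi> (r * 2 ^ i) + ennreal (real i * D)" by (rule Suc)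
      also have "\<Phi> (r * 2 ^ i) \<le> \<Phi> (2 * (r * 2 ^ i)) + ennreal D" using r by (intro \<Phi>_step) auto
      also have "\<Phi> (2 * (r * 2 ^ i)) + ennreal D + ennreal (real i * D) = \<Phi> (r * 2 ^ Suc i) + ennreal (real (Suc i) * D)"
      proof -
        have "ennreal D + ennreal (real i * D) = ennreal (D + real i * D)"
          using D by (intro ennreal_plus[symmetric]) auto
        then show ?thesis by (simp add: add.assoc distrib_right mult.left_commute)
      qed
      finally show ?case by (simp add: add_right_mono)
    qed simp
    have \<Phi>_fin: "\<Phi> r < top"
      unfolding \<Phi>_def cube_avg_def u_def using fin[of "2 * r"] r by (auto simp: ennreal_mult_less_top)
    \<comment> \<open>The mixture estimate is scale-free; \<open>p\<close> and \<open>\<kappa>\<close> are the distance and the averages in units of \<open>r\<close>.\<close>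
    have pointwise: "(\<Sum>i. ennreal ((1 - q) * q ^ i) * k (r * 2 ^ Suc i) y)
        + ennreal (c * r powr -\<theta>) * indicator (ball x r) y \<le> k r y" for y
    proof -
      define p where "p = dist x y / r"
      have p0: "0 \<le> p" using r by (simp add: p_def)
      have k_le: "k (r * 2 ^ Suc i) y \<le> ennreal (K * (r * 2 ^ Suc i) powr -\<theta>)" for i
        unfolding k_def K_def using \<theta> r by (intro cube_avg_kernel_le) auto
      define \<kappa> where "\<kappa> i = r powr \<theta> * enn2real (k (r * 2 ^ Suc i) y)" for i
      have rr: "r powr \<theta> * r powr -\<theta> = 1" using r by (simp add: powr_add[symmetric])
      have k_eq: "k (r * 2 ^ Suc i) y = ennreal (r powr -\<theta> * \<kappa> i)" for i
      proof -
        have "k (r * 2 ^ Suc i) y < top" using k_le[of i] by (auto intro: le_less_trans)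
        then have "k (r * 2 ^ Suc i) y = ennreal (enn2real (k (r * 2 ^ Suc i) y))" by simp
        also have "enn2real (k (r * 2 ^ Suc i) y) = r powr -\<theta> * \<kappa> i"
          using rr by (simp add: \<kappa>_def mult.assoc[symmetric] mult.commute[of "r powr -\<theta>"])
        finally show ?thesis .
      qed
      have \<kappa>_le: "\<kappa> i \<le> b" if "k (r * 2 ^ Suc i) y \<le> ennreal (r powr -\<theta> * b)" "0 \<le> b" for i b
      proof -
        have "r powr -\<theta> * \<kappa> i \<le> r powr -\<theta> * b" using that unfolding k_eq by (simp add: ennreal_le_iff)
        then show ?thesis using r by simp
      qed
      have mixp: "summable (\<lambda>i. (1 - q) * q ^ i * \<kappa> i) \<and>
       (\<Sum>i. (1 - q) * q ^ i * \<kappa> i) + (if p \<le> 1 then c else 0) \<le> (?n + p) powr -\<theta>"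
      proof (rule mix[rule_format, OF p0])
        show "0 \<le> \<kappa> i" for i by (simp add: \<kappa>_def)
        show "\<kappa> i \<le> K * (2 ^ Suc i) powr -\<theta>" for i
          using k_le[of i] K by (intro \<kappa>_le) (auto simp: powr_mult mult_ac)
        fix i :: nat assume i: "?n * 2 ^ Suc i < p"
        then have far: "?n * (r * 2 ^ Suc i) < dist x y" using r by (simp add: p_def field_simps)
        have "k (r * 2 ^ Suc i) y \<le> ennreal ((dist x y - ?n * (r * 2 ^ Suc i)) powr -\<theta>)"
          unfolding k_def using \<theta> r far by (intro cube_avg_kernel_le_far) auto
        also have "dist x y - ?n * (r * 2 ^ Suc i) = r * (p - ?n * 2 ^ Suc i)"
          using r by (simp add: p_def field_simps)
        finally show "\<kappa> i \<le> (p - ?n * 2 ^ Suc i) powr -\<theta>"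
          by (intro \<kappa>_le) (simp_all add: powr_mult)
      qed
      have sm: "summable (\<lambda>i. (1 - q) * q ^ i * (r powr -\<theta> * \<kappa> i))"
        using summable_mult[OF conjunct1[OF mixp], of "r powr -\<theta>"] by (simp add: mult_ac)
      have "(\<Sum>i. ennreal ((1 - q) * q ^ i) * k (r * 2 ^ Suc i) y)
         = (\<Sum>i. ennreal ((1 - q) * q ^ i * (r powr -\<theta> * \<kappa> i)))"
        unfolding k_eq using q by (intro suminf_cong ennreal_mult[symmetric]) (auto simp: \<kappa>_def)
      also have "\<dots> = ennreal (\<Sum>i. (1 - q) * q ^ i * (r powr -\<theta> * \<kappa> i))"
        using sm q by (intro suminf_ennreal2) (auto simp: \<kappa>_def)
      also have "(\<Sum>i. (1 - q) * q ^ i * (r powr -\<theta> * \<kappa> i)) = r powr -\<theta> * (\<Sum>i. (1 - q) * q ^ i * \<kappa> i)"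
        using suminf_mult[OF conjunct1[OF mixp], of "r powr -\<theta>"] by (simp add: mult_ac)
      finally have sum_eq: "(\<Sum>i. ennreal ((1 - q) * q ^ i) * k (r * 2 ^ Suc i) y)
         = ennreal (r powr -\<theta> * (\<Sum>i. (1 - q) * q ^ i * \<kappa> i))" .
      have pos: "0 \<le> (\<Sum>i. (1 - q) * q ^ i * \<kappa> i)"
        using mixp q by (intro suminf_nonneg) (auto simp: \<kappa>_def)
      have "(\<Sum>i. ennreal ((1 - q) * q ^ i) * k (r * 2 ^ Suc i) y)
        + ennreal (c * r powr -\<theta>) * indicator (ball x r) y
        \<le> ennreal (r powr -\<theta> * (\<Sum>i. (1 - q) * q ^ i * \<kappa> i)) + ennreal (r powr -\<theta> * (if p \<le> 1 then c else 0))"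
        unfolding sum_eq using r q by (intro add_left_mono) (auto simp: indicator_def p_def mult.commute)
      also have "\<dots> = ennreal (r powr -\<theta> * ((\<Sum>i. (1 - q) * q ^ i * \<kappa> i) + (if p \<le> 1 then c else 0)))"
        using pos q by (simp add: ennreal_plus[symmetric] distrib_left del: ennreal_plus)
      also have "\<dots> \<le> ennreal (r powr -\<theta> * (?n + p) powr -\<theta>)"
        using mixp by (intro ennreal_leI mult_left_mono) auto
      also have "r powr -\<theta> * (?n + p) powr -\<theta> = (?n * r + dist x y) powr -\<theta>"
      proof -
        have "?n * r + dist x y = r * (?n + p)" using r by (simp add: p_def field_simps)
        then show ?thesis by (simp add: powr_mult)
      qed
      also have "ennreal ((?n * r + dist x y) powr -\<theta>) \<le> k r y"
        unfolding k_def using \<theta> r by (intro cube_avg_kernel_ge) auto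
      finally show ?thesis .
    qed
    define P where "P i = ennreal ((1 - q) * q ^ i)" for i
    define N where "N = emeasure (density lborel h) (ball x r)"
    have "(\<Sum>i. P i * \<Phi> (r * 2 ^ Suc i)) + ennreal (c * r powr -\<theta>) * N
      = (\<integral>\<^sup>+ y. h y * ((\<Sum>i. P i * k (r * 2 ^ Suc i) y) + ennreal (c * r powr -\<theta>) * indicator (ball x r) y) \<partial>lborel)"
    proof -
      have 1: "(\<Sum>i. P i * \<Phi> (r * 2 ^ Suc i)) = (\<integral>\<^sup>+ y. (\<Sum>i. P i * (h y * k (r * 2 ^ Suc i) y)) \<partial>lborel)"
        unfolding \<Phi>_eq by (subst nn_integral_suminf) (measurable, simp add: nn_integral_cmult)
      have 2: "ennreal (c * r powr -\<theta>) * N = (\<integral>\<^sup>+ y. ennreal (c * r powr -\<theta>) * (h y * indicator (ball x r) y) \<partial>lborel)"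
        unfolding N_def by (subst emeasure_density, measurable, subst nn_integral_cmult) measurable
      show ?thesis unfolding 1 2
        by (subst nn_integral_add[symmetric], measurable, intro nn_integral_cong)
           (simp add: distrib_left ennreal_suminf_cmult[symmetric] mult_ac)
    qed
    also have "\<dots> \<le> (\<integral>\<^sup>+ y. h y * k r y \<partial>lborel)"
      unfolding P_def by (intro nn_integral_mono mult_left_mono pointwise) auto
    also have "\<dots> = \<Phi> r" by (rule \<Phi>_eq[symmetric])
    finally have lower: "(\<Sum>i. P i * \<Phi> (r * 2 ^ Suc i)) + ennreal (c * r powr -\<theta>) * N \<le> \<Phi> r" .
    have "(\<Sum>i. (1 - q) * q ^ i) = 1"
      using q by (subst suminf_mult) (auto simp: suminf_geometric)
    then have P_sum: "(\<Sum>i. P i) = 1"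
      unfolding P_def using q by (subst suminf_ennreal2) (auto intro!: summable_mult)
    have "\<Phi> r = (\<Sum>i. \<Phi> r * P i)" by (simp add: ennreal_suminf_cmult P_sum)
    also have "\<dots> \<le> (\<Sum>i. P i * \<Phi> (r * 2 ^ Suc i) + ennreal (D * ((1 - q) * (real (Suc i) * q ^ i))))"
    proof (intro suminf_le)
      fix i
      have "\<Phi> r * P i \<le> (\<Phi> (r * 2 ^ Suc i) + ennreal (real (Suc i) * D)) * P i"
        by (intro mult_right_mono \<Phi>_iter) auto
      also have "\<dots> = P i * \<Phi> (r * 2 ^ Suc i) + ennreal (D * ((1 - q) * (real (Suc i) * q ^ i)))"
      proof -
        have "ennreal (real (Suc i) * D) * P i = ennreal (real (Suc i) * D * ((1 - q) * q ^ i))"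
          unfolding P_def using q D by (intro ennreal_mult[symmetric]) auto
        also have "real (Suc i) * D * ((1 - q) * q ^ i) = D * ((1 - q) * (real (Suc i) * q ^ i))"
          by (simp only: mult_ac)
        finally show ?thesis by (simp only: distrib_right mult.commute[of "\<Phi> (r * 2 ^ Suc i)"])
      qed
      finally show "\<Phi> r * P i \<le> P i * \<Phi> (r * 2 ^ Suc i) + ennreal (D * ((1 - q) * (real (Suc i) * q ^ i)))" .
    qed auto
    also have "\<dots> = (\<Sum>i. P i * \<Phi> (r * 2 ^ Suc i)) + (\<Sum>i. ennreal (D * ((1 - q) * (real (Suc i) * q ^ i))))"
      by (rule suminf_add[symmetric]) auto
    also have "(\<Sum>i. ennreal (D * ((1 - q) * (real (Suc i) * q ^ i)))) = ennreal (D * S)"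
      unfolding S_def using q D S_summable
      by (subst suminf_ennreal2) (auto simp: suminf_mult intro!: summable_mult)
    finally have upper: "\<Phi> r \<le> (\<Sum>i. P i * \<Phi> (r * 2 ^ Suc i)) + ennreal (D * S)" .
    have "(\<Sum>i. P i * \<Phi> (r * 2 ^ Suc i)) < top"
      using lower \<Phi>_fin by (meson le_iff_add order_trans le_less_trans add_increasing2 order_refl zero_le)
    then have "ennreal (c * r powr -\<theta>) * N \<le> ennreal (D * S)"
      using order_trans[OF lower upper] by (auto simp: ennreal_add_left_cancel_le)
    moreover have "ennreal (1 / (r powr \<theta> / c)) = ennreal (c * r powr -\<theta>)"
      by (simp add: powr_minus_divide)
    ultimately have "N \<le> ennreal (r powr \<theta> / c) * ennreal (D * S)"
      using r q by (intro ennreal_le_of_inverse_mult_le) auto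
    also have "\<dots> = ennreal (C * X * r powr \<theta>)"
      using q D S by (simp add: ennreal_mult[symmetric] C_def D_def mult_ac)
    finally show "emeasure (density lborel h) (ball x r) \<le> ennreal (C * X * r powr \<theta>)"
      unfolding N_def .
  qed
qed

section \<open>Riesz potentials\<close>

lemma riesz_const_pos:
  assumes "0 < \<alpha>" "\<alpha> < real n"
  shows "0 < riesz_const n \<alpha>"
  using assms unfolding riesz_const_def
  by (intro divide_pos_pos mult_pos_pos Gamma_real_pos) auto

text \<open>
  A Lebesgue measurable density agrees almost everywhere with a Borel one. The two sides treat the
  point \<open>y = x\<close> differently (division by zero against \<open>0 powr -\<theta> = 0\<close>), which is a null set.
\<close>

lemma riesz_potential_eq_potential:
  fixes f :: "'a::euclidean_space \<Rightarrow> ennreal"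
  assumes \<alpha>: "0 < \<alpha>" "\<alpha> < real DIM('a)" and f: "f \<in> borel_measurable lebesgue"
  obtains h where "h \<in> borel_measurable borel"
    "riesz_potential \<alpha> f = potential (real DIM('a) - \<alpha>) (density lborel h)"
proof -
  define \<theta> where "\<theta> = real DIM('a) - \<alpha>"
  define \<gamma> where "\<gamma> = riesz_const DIM('a) \<alpha>"
  have \<gamma>: "0 < \<gamma>" using riesz_const_pos[OF \<alpha>] by (simp add: \<gamma>_def)
  obtain g where g: "g \<in> borel_measurable lborel" "AE x in lborel. f x = g x"
    using completion_ex_borel_measurable[OF f] by blast
  have [measurable]: "g \<in> borel_measurable borel" using g(1) by simp
  define h where "h y = g y / ennreal \<gamma>" for y
  have h [measurable]: "h \<in> borel_measurable borel" unfolding h_def by measurable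
  have "riesz_potential \<alpha> f x = potential \<theta> (density lborel h) x" for x
  proof -
    have "(\<integral>\<^sup>+ y. f y / ennreal (dist x y powr \<theta>) \<partial>lborel)
      = (\<integral>\<^sup>+ y. g y * ennreal (dist x y powr -\<theta>) \<partial>lborel)"
    proof (rule nn_integral_cong_AE)
      have "AE y in lborel. y \<noteq> x" by (rule AE_lborel_singleton)
      with g(2) show "AE y in lborel. f y / ennreal (dist x y powr \<theta>) = g y * ennreal (dist x y powr -\<theta>)"
      proof eventually_elim
        fix y assume "f y = g y" "y \<noteq> x"
        then show "f y / ennreal (dist x y powr \<theta>) = g y * ennreal (dist x y powr -\<theta>)"
          by (simp add: divide_ennreal_def inverse_ennreal powr_minus)
      qed
    qed
    then have "riesz_potential \<alpha> f x = (\<integral>\<^sup>+ y. g y * ennreal (dist x y powr -\<theta>) \<partial>lborel) / ennreal \<gamma>"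
      unfolding riesz_potential_def nn_integral_completion \<theta>_def \<gamma>_def by simp
    also have "\<dots> = (\<integral>\<^sup>+ y. (g y * ennreal (dist x y powr -\<theta>)) / ennreal \<gamma> \<partial>lborel)"
      by (rule nn_integral_divide[symmetric]) measurable
    also have "\<dots> = (\<integral>\<^sup>+ y. h y * ennreal (dist x y powr -\<theta>) \<partial>lborel)"
      by (simp add: h_def divide_ennreal_def mult_ac)
    also have "\<dots> = potential \<theta> (density lborel h) x"
      unfolding potential_def by (rule nn_integral_density[symmetric]) measurable
    finally show ?thesis .
  qed
  with h that show thesis unfolding \<theta>_def by blast
qed

lemma potential_measurable:
  fixes h :: "'a::euclidean_space \<Rightarrow> ennreal"
  assumes [measurable]: "h \<in> borel_measurable borel"
  shows "potential \<theta> (density lborel h) \<in> borel_measurable borel"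
proof -
  have "potential \<theta> (density lborel h) = (\<lambda>x. \<integral>\<^sup>+ y. h y * ennreal (dist x y powr -\<theta>) \<partial>lborel)"
    unfolding potential_def by (intro ext nn_integral_density) measurable
  then show ?thesis by simp
qed

lemma L1_loc_open_cube_finite:
  fixes v :: "'a::euclidean_space \<Rightarrow> ennreal"
  assumes "(\<lambda>x. enn2ereal (v x)) \<in> L1_loc"
  shows "(\<integral>\<^sup>+ x \<in> open_cube a l. v x \<partial>lborel) < \<infinity>"
proof -
  have "(\<integral>\<^sup>+ x \<in> open_cube a l. v x \<partial>lborel)
    \<le> (\<integral>\<^sup>+ x \<in> cbox a (a + l *\<^sub>R One). e2ennreal \<bar>enn2ereal (v x)\<bar> \<partial>lebesgue)"
    unfolding nn_integral_completion open_cube_def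
    using box_subset_cbox[of a "a + l *\<^sub>R One"] by (intro nn_integral_mono) (auto simp: indicator_def)
  also have "\<dots> < \<infinity>" using assms unfolding L1_loc_def by auto
  finally show ?thesis .
qed

lemma finite_point_in_open_cube:
  fixes v :: "'a::euclidean_space \<Rightarrow> ennreal"
  assumes "(\<integral>\<^sup>+ x \<in> open_cube a l. v x \<partial>lborel) < \<infinity>" and l: "0 < l"
  shows "\<exists>x\<in>open_cube a l. v x < top"
proof (rule ccontr)
  assume "\<not> ?thesis"
  then have "v x = top" if "x \<in> open_cube a l" for x using that by (auto simp: less_top[symmetric])
  then have "(\<integral>\<^sup>+ x \<in> open_cube a l. v x \<partial>lborel) = (\<integral>\<^sup>+ x. top * indicator (open_cube a l) x \<partial>lborel)"
    by (intro nn_integral_cong) (auto simp: indicator_def)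
  also have "\<dots> = top * emeasure lborel (open_cube a l)" by (intro nn_integral_cmult_indicator) simp
  also have "\<dots> = top" using l by (simp add: emeasure_open_cube ennreal_top_mult)
  finally show False using assms(1) by simp
qed

lemma BMO_norm_oscillation:
  fixes u :: "'a::euclidean_space \<Rightarrow> ereal"
  assumes "BMO_norm u < ennreal X" "0 < l"
  shows "\<exists>c::real. (\<integral>\<^sup>+ x \<in> open_cube a l. e2ennreal \<bar>u x - ereal c\<bar> \<partial>lborel) \<le> ennreal (l ^ DIM('a)) * ennreal X"
proof -
  let ?X = "\<lambda>c::real. (\<integral>\<^sup>+ x \<in> open_cube a l. e2ennreal \<bar>u x - ereal c\<bar> \<partial>lborel)"
  have "(INF c. ?X c / ennreal (l ^ DIM('a))) \<le> BMO_norm u"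
    unfolding BMO_norm_def nn_integral_completion using assms(2)
    by (intro SUP_upper2[of a] SUP_upper2[of l]) auto
  then have "(INF c. ?X c / ennreal (l ^ DIM('a))) < ennreal X" using assms(1) by (rule le_less_trans)
  then obtain c where "?X c / ennreal (l ^ DIM('a)) < ennreal X" by (auto simp: INF_less_iff)
  then have "ennreal (1 / l ^ DIM('a)) * ?X c \<le> ennreal X"
    using assms(2) by (simp add: divide_ennreal_def inverse_ennreal mult.commute inverse_eq_divide)
  then have "?X c \<le> ennreal (l ^ DIM('a)) * ennreal X"
    using assms(2) by (intro ennreal_le_of_inverse_mult_le) auto
  then show ?thesis ..
qed

text \<open>
  The growth condition holds with \<open>M\<close> proportional to any \<open>X\<close> above the norm, and \<open>X\<close> tends to the norm
  at the end. Working with a strict upper bound keeps \<open>M\<close> positive and makes a nearly optimal constant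
  available on each cube.
\<close>

theorem BMO_potential_imp_BMO_content:
  fixes \<theta> \<beta> :: real
  assumes \<theta>: "0 < \<theta>" "\<theta> < real DIM('a::euclidean_space)" and \<beta>: "\<theta> < \<beta>"
  obtains C where "0 < C"
    "\<And>h :: 'a \<Rightarrow> ennreal. h \<in> borel_measurable borel \<Longrightarrow>
      (\<lambda>x. enn2ereal (potential \<theta> (density lborel h) x)) \<in> BMO \<Longrightarrow>
      (\<lambda>x. enn2ereal (potential \<theta> (density lborel h) x)) \<in> BMO_content \<beta> \<and>
      BMO_content_norm \<beta> (\<lambda>x. enn2ereal (potential \<theta> (density lborel h) x))
        \<le> ennreal C * BMO_norm (\<lambda>x. enn2ereal (potential \<theta> (density lborel h) x))"
proof -
  obtain C1 where C1: "0 < C1" and morrey: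
    "\<And>(h :: 'a \<Rightarrow> ennreal) X x r. h \<in> borel_measurable borel \<Longrightarrow> 0 < X \<Longrightarrow> 0 < r \<Longrightarrow>
      (\<And>a l. 0 < l \<Longrightarrow> (\<integral>\<^sup>+ y \<in> open_cube a l. potential \<theta> (density lborel h) y \<partial>lborel) < \<infinity>) \<Longrightarrow>
      (\<And>a l. 0 < l \<Longrightarrow> \<exists>c::real. (\<integral>\<^sup>+ y \<in> open_cube a l.
          e2ennreal \<bar>enn2ereal (potential \<theta> (density lborel h) y) - ereal c\<bar> \<partial>lborel) \<le> ennreal (l ^ DIM('a)) * ennreal X) \<Longrightarrow>
      emeasure (density lborel h) (ball x r) \<le> ennreal (C1 * X * r powr \<theta>)"
    using BMO_potential_imp_morrey[OF \<theta>] by blast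
  define C2 where "C2 = real DIM('a) powr \<beta> * unit_ball_vol \<beta> *
    (\<theta> * 4 powr (\<theta> + 1) * 2 + 1 + 5 powr \<beta> * 2 powr \<theta> * (2 powr \<theta> / (1 - 2 powr ((\<theta> - \<beta>) / 2)))\<^sup>2)"
  have C2: "0 < C2" using \<theta> \<beta> unit_ball_vol_pos[of \<beta>] unfolding C2_def
    by (intro mult_pos_pos add_pos_nonneg) auto
  show thesis
  proof (rule that[of "C2 * C1"])
    show "0 < C2 * C1" using C1 C2 by simp
    fix h :: "'a \<Rightarrow> ennreal" assume h [measurable]: "h \<in> borel_measurable borel"
    let ?N = "density lborel h"
    let ?u = "\<lambda>x. enn2ereal (potential \<theta> ?N x)"
    assume u: "?u \<in> BMO"
    then have fin: "(\<integral>\<^sup>+ y \<in> open_cube a l. potential \<theta> ?N y \<partial>lborel) < \<infinity>" for a l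
      unfolding BMO_def by (intro L1_loc_open_cube_finite) auto
    obtain \<nu> where \<nu>: "BMO_norm ?u = ennreal \<nu>" "0 \<le> \<nu>"
      using u unfolding BMO_def by (cases "BMO_norm ?u") auto
    have morrey_measure: "morrey_measure ?N \<theta> (C1 * X)" if X: "\<nu> < X" for X
    proof
      have X0: "0 < X" using X \<nu> by simp
      then show "0 < C1 * X" using C1 by simp
      have "BMO_norm ?u < ennreal X" using \<nu> X by (simp add: ennreal_lessI)
      then show "emeasure ?N (ball x r) \<le> ennreal (C1 * X * r powr \<theta>)" if "0 < r" for x r
        using that X0 by (intro morrey h fin BMO_norm_oscillation)
    qed (use \<theta> in auto)
    have norm: "BMO_content_norm \<beta> ?u \<le> ennreal (C2 * (C1 * X))" and mem: "?u \<in> BMO_content \<beta>" if X: "\<nu> < X" for X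
    proof -
      interpret morrey_measure ?N \<theta> "C1 * X" using X by (rule morrey_measure)
      have fp: "\<exists>x\<in>open_cube a l. potential \<theta> ?N x < top" if "0 < l" for a l
        using fin that by (rule finite_point_in_open_cube)
      show "BMO_content_norm \<beta> ?u \<le> ennreal (C2 * (C1 * X))"
        using potential_BMO_content(2)[OF \<beta> fp] unfolding C2_def local_const_def by simp
      show "?u \<in> BMO_content \<beta>" using potential_BMO_content(1)[OF \<beta> fp] by simp
    qed
    have "BMO_content_norm \<beta> ?u \<le> ennreal (C2 * C1 * \<nu>)"
    proof (rule ennreal_le_epsilon)
      fix \<epsilon> :: real assume \<epsilon>: "0 < \<epsilon>"
      have "BMO_content_norm \<beta> ?u \<le> ennreal (C2 * (C1 * (\<nu> + \<epsilon> / (C2 * C1))))"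
        using \<epsilon> C1 C2 by (intro norm) auto
      also have "C2 * (C1 * (\<nu> + \<epsilon> / (C2 * C1))) = C2 * C1 * \<nu> + \<epsilon>"
        using C1 C2 by (simp add: field_simps)
      also have "ennreal (C2 * C1 * \<nu> + \<epsilon>) = ennreal (C2 * C1 * \<nu>) + ennreal \<epsilon>"
        using C1 C2 \<nu> \<epsilon> by (intro ennreal_plus) auto
      finally show "BMO_content_norm \<beta> ?u \<le> ennreal (C2 * C1 * \<nu>) + ennreal \<epsilon>" .
    qed
    then show "?u \<in> BMO_content \<beta> \<and> BMO_content_norm \<beta> ?u \<le> ennreal (C2 * C1) * BMO_norm ?u"
      using mem[of "\<nu> + 1"] C1 C2 \<nu> by (simp add: ennreal_mult)
  qed
qed

theorem theorem1p6:
  fixes \<alpha> \<beta> :: real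
  assumes "0 < \<alpha>" and "\<alpha> < real CARD('n::finite)"
    and "\<beta> \<in> {real CARD('n) - \<alpha> <.. real CARD('n)}"
  defines "I \<equiv> (\<lambda>(f :: real ^ 'n \<Rightarrow> ennreal) x. enn2ereal (riesz_potential \<alpha> f x))"
  shows "(\<forall>f \<in> borel_measurable lebesgue. I f \<in> BMO \<longleftrightarrow> I f \<in> BMO_content \<beta>) \<and>
    (\<exists>C::real. C \<ge> 1 \<and>
      (\<forall>f \<in> borel_measurable lebesgue. I f \<in> BMO \<longrightarrow>
         ennreal (1 / C) * BMO_norm (I f) \<le> BMO_content_norm \<beta> (I f) \<and>
         BMO_content_norm \<beta> (I f) \<le> ennreal C * BMO_norm (I f)))"
proof -
  let ?n = "real CARD('n)"
  define \<theta> where "\<theta> = ?n - \<alpha>"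
  have dim: "real DIM(real ^ 'n) = ?n" by simp
  have \<theta>: "0 < \<theta>" "\<theta> < real DIM(real ^ 'n)" "\<theta> < \<beta>" using assms by (auto simp: \<theta>_def)
  have \<beta>: "0 < \<beta>" "\<beta> \<le> real DIM(real ^ 'n)" using assms \<theta> by auto
  obtain C2 where C2: "0 < C2" and up: "\<And>h :: real ^ 'n \<Rightarrow> ennreal. h \<in> borel_measurable borel \<Longrightarrow>
      (\<lambda>x. enn2ereal (potential \<theta> (density lborel h) x)) \<in> BMO \<Longrightarrow>
      (\<lambda>x. enn2ereal (potential \<theta> (density lborel h) x)) \<in> BMO_content \<beta> \<and>
      BMO_content_norm \<beta> (\<lambda>x. enn2ereal (potential \<theta> (density lborel h) x))
        \<le> ennreal C2 * BMO_norm (\<lambda>x. enn2ereal (potential \<theta> (density lborel h) x))"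
    using BMO_potential_imp_BMO_content[OF \<theta>] by blast
  define C1 where "C1 = (1 + unit_ball_vol ?n) / unit_ball_vol \<beta>"
  define C where "C = max 1 (max C1 C2)"
  have C: "1 \<le> C" "C1 \<le> C" "C2 \<le> C" by (auto simp: C_def)
  have main: "(I f \<in> BMO \<longleftrightarrow> I f \<in> BMO_content \<beta>) \<and> (I f \<in> BMO \<longrightarrow>
         ennreal (1 / C) * BMO_norm (I f) \<le> BMO_content_norm \<beta> (I f) \<and>
         BMO_content_norm \<beta> (I f) \<le> ennreal C * BMO_norm (I f))"
    if f: "f \<in> borel_measurable lebesgue" for f :: "real ^ 'n \<Rightarrow> ennreal"
  proof -
    obtain h :: "real ^ 'n \<Rightarrow> ennreal" where h: "h \<in> borel_measurable borel"
      "riesz_potential \<alpha> f = potential \<theta> (density lborel h)"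
      using riesz_potential_eq_potential[OF assms(1) _ f] assms(2) unfolding \<theta>_def dim by blast
    have I: "I f = (\<lambda>x. enn2ereal (potential \<theta> (density lborel h) x))"
      unfolding I_def h(2) ..
    note v = potential_measurable[OF h(1), of \<theta>]
    have low: "BMO_norm (I f) \<le> ennreal C1 * BMO_content_norm \<beta> (I f)"
      using BMO_norm_le_content_norm[OF v \<beta>] unfolding I C1_def dim .
    have "I f \<in> BMO" if "I f \<in> BMO_content \<beta>"
    proof -
      have "I f \<in> L1_loc"
        using that unfolding I BMO_content_def by (intro L1_loc_of_content[OF v \<beta>]) auto
      moreover have "ennreal C1 * BMO_content_norm \<beta> (I f) < \<infinity>"
        using that unfolding BMO_content_def by (auto simp: ennreal_mult_less_top)
      ultimately show ?thesis unfolding BMO_def using low by (auto intro: le_less_trans)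
    qed
    moreover have "I f \<in> BMO_content \<beta>" if "I f \<in> BMO"
      using up[OF h(1)] that unfolding I by blast
    moreover have "BMO_content_norm \<beta> (I f) \<le> ennreal C * BMO_norm (I f)" if "I f \<in> BMO"
    proof -
      have "BMO_content_norm \<beta> (I f) \<le> ennreal C2 * BMO_norm (I f)"
        using up[OF h(1)] that unfolding I by blast
      also have "\<dots> \<le> ennreal C * BMO_norm (I f)" using C by (intro mult_right_mono ennreal_leI) auto
      finally show ?thesis .
    qed
    moreover have "ennreal (1 / C) * BMO_norm (I f) \<le> BMO_content_norm \<beta> (I f)"
    proof -
      have "BMO_norm (I f) \<le> ennreal C * BMO_content_norm \<beta> (I f)"
        using C by (intro order_trans[OF low] mult_right_mono ennreal_leI) auto
      then have "ennreal (1 / C) * BMO_norm (I f) \<le> ennreal (1 / C) * (ennreal C * BMO_content_norm \<beta> (I f))"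
        by (intro mult_left_mono) auto
      also have "\<dots> = BMO_content_norm \<beta> (I f)"
        using C by (simp add: mult.assoc[symmetric] ennreal_mult[symmetric])
      finally show ?thesis .
    qed
    ultimately show ?thesis by blast
  qed
  then show ?thesis using C(1) by blast
qed

end
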